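(* Let $T$ be a classical $3$-tangle with standard orientation. For any classical $3$-tangle $T'$ with compatible orientation, $f(\rho^3(T)\cup T')-f(T\cup T')$ is divisible in $\mathbb{Z}[A,A^{-1}]$ by $f(T(m_{a_1}))-f(T(m_{a_2}))$, where $m_{a_1}=((1,2),(3,4),(5,6))$ and $m_{a_2}=((1,6),(2,3),(4,5))$.
   Context: **Auxiliary polynomial.** For an oriented link diagram $D$, $f(D)=(-A^3)^{-w(D)}\langle D\rangle\in\mathbb{Z}[A,A^{-1}]$, where $w$ is the writhe and $\langle\cdot\rangle$ is the Kauffman bracket: at a crossing drawn so that the over-strand runs from bottom left to top right, $\langle D\rangle=A\langle D_A\rangle+A^{-1}\langle D_B\rangle$, where $D_A$ joins the two left ends together and the two right ends together, and $D_B$ joins the two top ends together and the two bottom ends together; $\langle\bigcirc\sqcup D\rangle=(-A^2-A^{-2})\langle D\rangle$; $\langle\bigcirc\rangle=1$. **Tangles.** A classical $n$-tangle is a tangle diagram (no virtual crossings) in a disk with $2n$ endpoints on the boundary circle, the $i$-th at angle $-\pi i/n$; closed components are allowed. $T\cup T'$ is the link diagram obtained by gluing the $i$-th endpoint of $T$ to the $i$-th endpoint of a complementary tangle $T'$ (planarly, so $T \cup T'$ is classical). $T$ has standard orientation if its endpoints $1,2,\dots,2n$ are alternately outbound, inbound, outbound, inbound, …; $T'$ has compatible orientation if the orientations of $T$ and $T'$ agree at the glued endpoints. **Rotation.** $r^k(T)$ is the rotation of $T$ clockwise by $k\pi/n$ radians. For $T$ with standard orientation, $\rho^k(T)=r^k(T)$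 if $k$ is even, and if $k$ is odd $\rho^k(T)$ is $r^k(T)$ with the orientation of every strand (including closed components) reversed; so $\rho^k(T)$ has standard orientation. **Closures.** For a noncrossing perfect matching $m$ of $\{1,\dots,2n\}$, $T(m)$ is the link diagram obtained by joining the endpoints $i,j$ of $T$ by an arc outside the disk for each pair $(i,j)$ of $m$, without introducing crossings; it inherits the orientation of $T$. *)

theory Defs
  imports "HOL-Library.Poly_Mapping" "HOL-Library.Disjoint_Sets"
begin

section \<open>The ring of integral Laurent polynomials\<close>

text \<open>Finitely supported functions from exponents to coefficients, multiplied by convolution.\<close>

type_synonym laurent = "int \<Rightarrow>\<^sub>0 int"

definition A_pow :: "int \<Rightarrow> laurent" where
  "A_pow k = Poly_Mapping.single k 1"

lemma A_pow_0: "A_pow 0 = 1"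
  by (simp add: A_pow_def)

lemma A_pow_add: "A_pow (j + k) = A_pow j * A_pow k"
  by (simp add: A_pow_def mult_single)

section \<open>Tangle diagrams\<close>

text \<open>
  A diagram is encoded by its combinatorial map. Cutting the diagram at all its vertices leaves
  edges, each with two ends, called darts. The vertices are

  \<^item> the crossings, each a tuple \<open>(a, b, c, d)\<close> of its four darts in counterclockwise order such
    that \<open>a\<close>, \<open>c\<close> belong to the over-strand and \<open>b\<close>, \<open>d\<close> to the under-strand; one of
    the two such tuples is chosen for every crossing;
  \<^item> the joints, two-valent marked points of the strands, which do not alter the diagram: they are
    the points where tangles have been glued or a crossing has been smoothed, and they allow
    circles without crossings;
  \<^item> the endpoints on the boundary circle, endpoint \<open>i\<close> being item \<open>i - 1\<close> of the list.

  Every edge is directed from its dart in \<open>tails\<close> to its other dart. A link diagram is a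
  diagram without endpoints.
\<close>

record 'd tangle =
  edges :: "'d set set"
  joints :: "'d set set"
  crossings :: "('d \<times> 'd \<times> 'd \<times> 'd) set"
  endpoints :: "'d list"
  tails :: "'d set"

definition darts :: "'d tangle \<Rightarrow> 'd set" where
  "darts T = \<Union>(edges T)"

definition corners :: "'d \<times> 'd \<times> 'd \<times> 'd \<Rightarrow> 'd set" where
  "corners = (\<lambda>(a, b, c, d). {a, b, c, d})"

definition tangle_diagram :: "nat \<Rightarrow> 'd tangle \<Rightarrow> bool" where
  "tangle_diagram n T \<longleftrightarrow>
     finite (darts T) \<and>
     disjoint (edges T) \<and> (\<forall>e\<in>edges T. card e = 2) \<and>
     disjoint (joints T) \<and> (\<forall>j\<in>joints T. card j = 2) \<and>
     disjoint_family_on corners (crossings T) \<and>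
     (\<forall>(a, b, c, d)\<in>crossings T. distinct [a, b, c, d]) \<and>
     length (endpoints T) = 2 * n \<and> distinct (endpoints T) \<and>
     set (endpoints T) \<inter> \<Union>(joints T) = {} \<and>
     set (endpoints T) \<inter> \<Union>(corners ` crossings T) = {} \<and>
     \<Union>(joints T) \<inter> \<Union>(corners ` crossings T) = {} \<and>
     darts T = set (endpoints T) \<union> \<Union>(joints T) \<union> \<Union>(corners ` crossings T)"

definition oriented :: "'d tangle \<Rightarrow> bool" where
  "oriented T \<longleftrightarrow>
     tails T \<subseteq> darts T \<and>
     (\<forall>e\<in>edges T. card (e \<inter> tails T) = 1) \<and>
     (\<forall>j\<in>joints T. card (j \<inter> tails T) = 1) \<and>
     (\<forall>(a, b, c, d)\<in>crossings T. (a \<in> tails T) \<noteq> (c \<in> tails T) \<and> (b \<in> tails T) \<noteq> (d \<in> tails T))"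

section \<open>Planarity\<close>

definition num_classes :: "'d set \<Rightarrow> ('d \<times> 'd) set \<Rightarrow> nat" where
  "num_classes H R = card (H // {(x, y). x \<in> H \<and> y \<in> H \<and> (x, y) \<in> (R \<union> R\<inverse>)\<^sup>*})"

definition edge_rel :: "'d tangle \<Rightarrow> ('d \<times> 'd) set" where
  "edge_rel T = {(x, y). {x, y} \<in> edges T}"

definition joint_rel :: "'d tangle \<Rightarrow> ('d \<times> 'd) set" where
  "joint_rel T = {(x, y). {x, y} \<in> joints T}"

text \<open>
  The counterclockwise successor of a dart at its vertex. The region beyond the boundary circle is
  collapsed to a single vertex, whose darts are the endpoints in the counterclockwise order \<open>bs\<close>.
\<close>

definition next_rel :: "'d list \<Rightarrow> 'd tangle \<Rightarrow> ('d \<times> 'd) set" where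
  "next_rel bs T =
     joint_rel T \<union>
     (\<Union>(a, b, c, d)\<in>crossings T. {(a, b), (b, c), (c, d), (d, a)}) \<union>
     set (zip bs (rotate1 bs))"

text \<open>
  Every connected component of the resulting map on a closed oriented surface has genus 0, that is,
  the Euler characteristic is twice the number of components. The faces are the cycles that first
  traverse an edge and then turn to the next dart. (The Euler characteristic is at most this value
  for each component, so it suffices to compare the totals.)
\<close>

definition planar :: "'d list \<Rightarrow> 'd tangle \<Rightarrow> bool" where
  "planar bs T \<longleftrightarrow>
     int (num_classes (darts T) (next_rel bs T))
     - int (card (edges T))
     + int (num_classes (darts T) (edge_rel T O next_rel bs T))
     = 2 * int (num_classes (darts T) (edge_rel T \<union> next_rel bs T))"

text \<open>
  Endpoints are numbered clockwise around the disk, which is the counterclockwise order around a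
  vertex outside the disk. A complementary tangle lies outside the disk of the tangle that it is
  glued to; then it is the disk that is collapsed to a vertex, and the order is the reverse.
\<close>

definition classical_tangle :: "nat \<Rightarrow> 'd tangle \<Rightarrow> bool" where
  "classical_tangle n T \<longleftrightarrow> tangle_diagram n T \<and> oriented T \<and> planar (endpoints T) T"

definition classical_complementary_tangle :: "nat \<Rightarrow> 'd tangle \<Rightarrow> bool" where
  "classical_complementary_tangle n T \<longleftrightarrow>
     tangle_diagram n T \<and> oriented T \<and> planar (rev (endpoints T)) T"

section \<open>Orientations, gluing, rotation and closures\<close>

text \<open>
  A strand is outbound at an endpoint iff the dart there is not a tail. In the standard orientation
  the endpoints 1, 3, 5, \<dots>, that is the list items 0, 2, 4, \<dots>, are outbound.
\<close>

definition standard_orientation :: "'d tangle \<Rightarrow> bool" where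
  "standard_orientation T \<longleftrightarrow>
     (\<forall>i<length (endpoints T). endpoints T ! i \<notin> tails T \<longleftrightarrow> even i)"

text \<open>A strand that leaves one tangle at a common endpoint enters the other one there.\<close>

definition compatible_orientation :: "'d tangle \<Rightarrow> 'e tangle \<Rightarrow> bool" where
  "compatible_orientation T T' \<longleftrightarrow>
     length (endpoints T) = length (endpoints T') \<and>
     (\<forall>i<length (endpoints T). endpoints T ! i \<in> tails T \<longleftrightarrow> endpoints T' ! i \<notin> tails T')"

definition map_crossing :: "('d \<Rightarrow> 'e) \<Rightarrow> 'd \<times> 'd \<times> 'd \<times> 'd \<Rightarrow> 'e \<times> 'e \<times> 'e \<times> 'e" where
  "map_crossing f = (\<lambda>(a, b, c, d). (f a, f b, f c, f d))"

text \<open>The link diagram \<open>T \<union> T'\<close>.\<close>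

definition glue :: "'d tangle \<Rightarrow> 'e tangle \<Rightarrow> ('d + 'e) tangle" where
  "glue T T' =
    \<lparr>edges = image Inl ` edges T \<union> image Inr ` edges T',
     joints = image Inl ` joints T \<union> image Inr ` joints T' \<union>
       {{Inl p, Inr q} | p q. (p, q) \<in> set (zip (endpoints T) (endpoints T'))},
     crossings = map_crossing Inl ` crossings T \<union> map_crossing Inr ` crossings T',
     endpoints = [],
     tails = Inl ` tails T \<union> Inr ` tails T'\<rparr>"

text \<open>Clockwise rotation by \<open>\<pi> / n\<close> moves endpoint \<open>i\<close> to position \<open>i + 1\<close>, and \<open>2 n\<close> to \<open>1\<close>.\<close>

definition rot :: "'d tangle \<Rightarrow> 'd tangle" where
  "rot T = T\<lparr>endpoints := last (endpoints T) # butlast (endpoints T)\<rparr>"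

definition reverse_orientation :: "'d tangle \<Rightarrow> 'd tangle" where
  "reverse_orientation T = T\<lparr>tails := darts T - tails T\<rparr>"

definition rho :: "nat \<Rightarrow> 'd tangle \<Rightarrow> 'd tangle" where
  "rho k T = (if even k then (rot ^^ k) T else reverse_orientation ((rot ^^ k) T))"

text \<open>
  The crossingless complementary tangle formed by arcs that join the endpoints paired by \<open>m\<close>. The
  natural number \<open>i\<close> is the dart at endpoint \<open>i\<close>, and the orientation is inherited from \<open>T\<close>.
\<close>

definition arcs :: "nat set set \<Rightarrow> 'd tangle \<Rightarrow> nat tangle" where
  "arcs m T =
    \<lparr>edges = m, joints = {}, crossings = {},
     endpoints = [1..<Suc (length (endpoints T))],
     tails = {i\<in>{1..length (endpoints T)}. endpoints T ! (i - 1) \<notin> tails T}\<rparr>"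

definition tangle_closure :: "'d tangle \<Rightarrow> nat set set \<Rightarrow> ('d + nat) tangle" where
  "tangle_closure T m = glue T (arcs m T)"

definition m_a1 :: "nat set set" where
  "m_a1 = {{1, 2}, {3, 4}, {5, 6}}"

definition m_a2 :: "nat set set" where
  "m_a2 = {{1, 6}, {2, 3}, {4, 5}}"

section \<open>The Kauffman bracket and the auxiliary polynomial\<close>

text \<open>
  If the over-strand of a crossing \<open>(a, b, c, d)\<close> runs from bottom left \<open>a\<close> to top right \<open>c\<close>, then
  \<open>b\<close> is bottom right and \<open>d\<close> is top left.
\<close>

definition smooth_A :: "'d \<times> 'd \<times> 'd \<times> 'd \<Rightarrow> 'd tangle \<Rightarrow> 'd tangle" where
  "smooth_A = (\<lambda>(a, b, c, d) D.
     D\<lparr>joints := joints D \<union> {{a, d}, {b, c}}, crossings := crossings D - {(a, b, c, d)}\<rparr>)"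

definition smooth_B :: "'d \<times> 'd \<times> 'd \<times> 'd \<Rightarrow> 'd tangle \<Rightarrow> 'd tangle" where
  "smooth_B = (\<lambda>(a, b, c, d) D.
     D\<lparr>joints := joints D \<union> {{a, b}, {c, d}}, crossings := crossings D - {(a, b, c, d)}\<rparr>)"

lemma smooth_simps [simp]:
  "crossings (smooth_A x D) = crossings D - {x}"
  "crossings (smooth_B x D) = crossings D - {x}"
  "edges (smooth_A x D) = edges D"
  "edges (smooth_B x D) = edges D"
  by (simp_all add: smooth_A_def smooth_B_def split: prod.splits)

definition num_circles :: "'d tangle \<Rightarrow> nat" where
  "num_circles D = num_classes (darts D) (edge_rel D \<union> joint_rel D)"

definition loop_value :: laurent where
  "loop_value = - A_pow 2 - A_pow (- 2)"

text \<open>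
  The crossing to be expanded is chosen arbitrarily; by \<open>bracket_skein\<close> below the skein relation
  then holds at every crossing. A crossingless link diagram consists of disjoint circles.
\<close>

function bracket :: "'d tangle \<Rightarrow> laurent" where
  "bracket D =
    (if finite (crossings D) \<and> crossings D \<noteq> {}
     then let x = SOME x. x \<in> crossings D
          in A_pow 1 * bracket (smooth_A x D) + A_pow (- 1) * bracket (smooth_B x D)
     else loop_value ^ (num_circles D - 1))"
  by auto
termination
  by (relation "measure (\<lambda>D. card (crossings D))")
    (auto intro!: psubset_card_mono simp: some_in_eq card_gt_0_iff)

declare bracket.simps [simp del]

text \<open>
  The strand with ends \<open>a\<close>, \<open>c\<close> leaves the crossing through \<open>a\<close> iff \<open>a\<close> is a tail. With \<open>a\<close>,
  \<open>b\<close>, \<open>c\<close>, \<open>d\<close> in counterclockwise order, the crossing is positive iff the over-strand and the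
  under-strand leave through \<open>a\<close> and \<open>b\<close>, or through \<open>c\<close> and \<open>d\<close>.
\<close>

definition crossing_sign :: "'d tangle \<Rightarrow> 'd \<times> 'd \<times> 'd \<times> 'd \<Rightarrow> int" where
  "crossing_sign D = (\<lambda>(a, b, c, d). if a \<in> tails D \<longleftrightarrow> b \<in> tails D then 1 else - 1)"

definition writhe :: "'d tangle \<Rightarrow> int" where
  "writhe D = (\<Sum>x\<in>crossings D. crossing_sign D x)"

text \<open>The power \<open>(- A\<^sup>3)\<^sup>k\<close> for an integer \<open>k\<close>; the inverse of \<open>- A\<^sup>3\<close> is \<open>- A\<close> to the power \<open>- 3\<close>.\<close>

definition minus_A3_pow :: "int \<Rightarrow> laurent" where
  "minus_A3_pow k = (if k \<ge> 0 then (- A_pow 3) ^ nat k else (- A_pow (- 3)) ^ nat (- k))"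

definition aux_poly :: "'d tangle \<Rightarrow> laurent" where
  "aux_poly D = minus_A3_pow (- writhe D) * bracket D"

section \<open>The defining relations of the bracket\<close>

lemma smooth_commute:
  "smooth_A x (smooth_A y D) = smooth_A y (smooth_A x D)"
  "smooth_A x (smooth_B y D) = smooth_B y (smooth_A x D)"
  "smooth_B x (smooth_B y D) = smooth_B y (smooth_B x D)"
  by (cases x; cases y; cases D;
      simp add: smooth_A_def smooth_B_def Un_ac insert_commute Diff_insert2 [symmetric];
      blast)+

lemma bracket_skein:
  assumes "finite (crossings D)" "x \<in> crossings D"
  shows "bracket D = A_pow 1 * bracket (smooth_A x D) + A_pow (- 1) * bracket (smooth_B x D)"
  using assms
proof (induction "card (crossings D)" arbitrary: D x rule: less_induct)
  case less
  define y where "y = (SOME y. y \<in> crossings D)"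
  have y: "y \<in> crossings D"
    using less.prems unfolding y_def by (metis someI)
  have D: "bracket D = A_pow 1 * bracket (smooth_A y D) + A_pow (- 1) * bracket (smooth_B y D)"
    using less.prems by (subst bracket.simps) (auto simp: y_def Let_def)
  show ?case
  proof (cases "x = y")
    case True
    then show ?thesis using D by simp
  next
    case False
    have "card (crossings D) > 0"
      using less.prems by (auto simp: card_gt_0_iff)
    then have "bracket (smooth_A y D) =
        A_pow 1 * bracket (smooth_A x (smooth_A y D)) + A_pow (- 1) * bracket (smooth_B x (smooth_A y D))"
      "bracket (smooth_B y D) =
        A_pow 1 * bracket (smooth_A x (smooth_B y D)) + A_pow (- 1) * bracket (smooth_B x (smooth_B y D))"
      "bracket (smooth_A x D) =
        A_pow 1 * bracket (smooth_A y (smooth_A x D)) + A_pow (- 1) * bracket (smooth_B y (smooth_A x D))"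
      "bracket (smooth_B x D) =
        A_pow 1 * bracket (smooth_A y (smooth_B x D)) + A_pow (- 1) * bracket (smooth_B y (smooth_B x D))"
      using less.prems y False by (auto intro!: less.hyps)
    then show ?thesis
      unfolding D by (simp add: smooth_commute[of x y] smooth_commute(2)[of y x] algebra_simps)
  qed
qed

text \<open>
  The remaining relations: a single circle has bracket 1, and adding a circle multiplies the
  bracket by \<open>- A\<^sup>2 - A\<close> to the power \<open>- 2\<close>. The circle is formed by two new darts.
\<close>

definition add_circle :: "'d \<Rightarrow> 'd \<Rightarrow> 'd tangle \<Rightarrow> 'd tangle" where
  "add_circle p q D = D\<lparr>edges := insert {p, q} (edges D), joints := insert {p, q} (joints D)\<rparr>"

lemma bracket_circle:
  assumes "crossings D = {}" "edges D = {{p, q}}" "joints D = {{p, q}}"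
  shows "bracket D = 1"
proof -
  let ?r = "{(x, y). x \<in> {p, q} \<and> y \<in> {p, q} \<and>
    (x, y) \<in> ((edge_rel D \<union> joint_rel D) \<union> (edge_rel D \<union> joint_rel D)\<inverse>)\<^sup>*}"
  have "(p, q) \<in> edge_rel D" "(q, p) \<in> edge_rel D"
    using assms by (auto simp: edge_rel_def insert_commute)
  then have "?r = {p, q} \<times> {p, q}"
    by (auto intro!: r_into_rtrancl)
  then have "{p, q} // ?r = {{p, q}}"
    by (auto simp: quotient_def)
  then have "num_circles D = 1"
    using assms by (simp add: num_circles_def num_classes_def darts_def)
  then show ?thesis
    using assms(1) by (subst bracket.simps) simp
qed

lemma num_classes_add_pair:
  assumes "finite H" "R \<subseteq> H \<times> H" "p \<notin> H" "q \<notin> H"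
  shows "num_classes (H \<union> {p, q}) (R \<union> {(p, q), (q, p)}) = Suc (num_classes H R)"
proof -
  define S where "S = R \<union> R\<inverse>"
  define S' where "S' = S \<union> {(p, q), (q, p)}"
  define r where "r = {(x, y). x \<in> H \<and> y \<in> H \<and> (x, y) \<in> S\<^sup>*}"
  define r' where "r' = {(x, y). x \<in> H \<union> {p, q} \<and> y \<in> H \<union> {p, q} \<and> (x, y) \<in> S'\<^sup>*}"
  have S: "S \<subseteq> H \<times> H" using assms(2) by (auto simp: S_def)
  have old: "y \<in> H \<and> (x, y) \<in> S\<^sup>*" if "(x, y) \<in> S'\<^sup>*" "x \<in> H" for x y
    using that
  proof (induction rule: rtrancl_induct)
    case base
    then show ?case by simp
  next
    case (step y z)
    then have "(y, z) \<in> S" using assms(3,4) by (auto simp: S'_def)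
    then show ?case using step S by (auto intro: rtrancl_into_rtrancl)
  qed
  have new: "y \<in> {p, q}" if "(x, y) \<in> S'\<^sup>*" "x \<in> {p, q}" for x y
    using that
  proof (induction rule: rtrancl_induct)
    case base
    then show ?case by simp
  next
    case (step y z)
    then show ?case using assms(3,4) S by (auto simp: S'_def)
  qed
  have mono: "S\<^sup>* \<subseteq> S'\<^sup>*" by (rule rtrancl_mono) (auto simp: S'_def)
  have 1: "r' `` {x} = r `` {x}" if "x \<in> H" for x
    using that old[of x] mono unfolding r_def r'_def by blast
  have "(p, q) \<in> S'\<^sup>*" "(q, p) \<in> S'\<^sup>*" by (auto simp: S'_def intro: r_into_rtrancl)
  then have 2: "r' `` {x} = {p, q}" if "x \<in> {p, q}" for x
    using that new[of x] unfolding r'_def by auto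
  have "(H \<union> {p, q}) // r' = insert {p, q} (H // r)"
    unfolding quotient_def using 1 2 by auto
  moreover have "{p, q} \<notin> H // r"
    using assms(3) by (auto simp: quotient_def r_def)
  moreover have "finite (H // r)"
    using assms(1) by (simp add: quotient_def)
  ultimately have "card ((H \<union> {p, q}) // r') = Suc (card (H // r))"
    by simp
  moreover have "R \<union> {(p, q), (q, p)} \<union> (R \<union> {(p, q), (q, p)})\<inverse> = S'"
    by (auto simp: S_def S'_def)
  ultimately show ?thesis
    by (simp add: num_classes_def r_def r'_def S_def)
qed

lemma bracket_add_circle:
  assumes "finite (darts D)" "darts D \<noteq> {}" "finite (crossings D)"
    and "\<Union>(joints D) \<subseteq> darts D" "\<Union>(corners ` crossings D) \<subseteq> darts D"
    and "p \<notin> darts D" "q \<notin> darts D"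
  shows "bracket (add_circle p q D) = loop_value * bracket D"
  using assms
proof (induction "card (crossings D)" arbitrary: D rule: less_induct)
  case less
  show ?case
  proof (cases "crossings D = {}")
    case True
    let ?R = "edge_rel D \<union> joint_rel D"
    have R: "?R \<subseteq> darts D \<times> darts D"
      using less.prems(4) by (auto simp: edge_rel_def joint_rel_def darts_def)
    have rel: "edge_rel (add_circle p q D) \<union> joint_rel (add_circle p q D) = ?R \<union> {(p, q), (q, p)}"
      by (auto simp: edge_rel_def joint_rel_def add_circle_def doubleton_eq_iff)
    have "darts (add_circle p q D) = darts D \<union> {p, q}"
      by (auto simp: darts_def add_circle_def)
    then have "num_circles (add_circle p q D) = Suc (num_circles D)"
      unfolding num_circles_def rel
      using num_classes_add_pair[OF less.prems(1) R less.prems(6,7)] by simp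
    moreover have "num_circles D > 0"
      using less.prems(1,2) by (auto simp: num_circles_def num_classes_def card_gt_0_iff quotient_def)
    moreover have "crossings (add_circle p q D) = {}"
      using True by (simp add: add_circle_def)
    ultimately show ?thesis
      using True by (cases "num_circles D") (simp_all add: bracket.simps[of D] bracket.simps[of "add_circle p q D"])
  next
    case False
    then obtain x where x: "x \<in> crossings D" by blast
    have A: "smooth_A x (add_circle p q D) = add_circle p q (smooth_A x D)"
      and B: "smooth_B x (add_circle p q D) = add_circle p q (smooth_B x D)"
      by (cases x; simp add: smooth_A_def smooth_B_def add_circle_def insert_commute)+
    have "darts (smooth_A x D) = darts D" "darts (smooth_B x D) = darts D"
      by (simp_all add: darts_def)
    moreover have "corners x \<subseteq> darts D"
      using less.prems(5) x by blast
    then have "\<Union>(joints (smooth_A x D)) \<subseteq> darts D" "\<Union>(joints (smooth_B x D)) \<subseteq> darts D"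
      using less.prems(4) by (cases x; simp add: smooth_A_def smooth_B_def corners_def)+
    moreover have "card (crossings D - {x}) < card (crossings D)"
      by (rule card_Diff1_less) (use less.prems(3) x in auto)
    moreover have "\<Union>(corners ` (crossings D - {x})) \<subseteq> darts D"
      using less.prems(5) by blast
    ultimately have
      "bracket (add_circle p q (smooth_A x D)) = loop_value * bracket (smooth_A x D)"
      "bracket (add_circle p q (smooth_B x D)) = loop_value * bracket (smooth_B x D)"
      using less.prems by (intro less.hyps; simp only: smooth_simps finite_Diff; fail)+
    moreover have "finite (crossings (add_circle p q D))" "x \<in> crossings (add_circle p q D)"
      using x less.prems(3) by (simp_all add: add_circle_def)
    ultimately show ?thesis
      using x less.prems(3)
      by (simp add: bracket_skein[of "add_circle p q D" x] bracket_skein[of D x] A B algebra_simps)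
  qed
qed

end

theory Submission
  imports Defs
begin

text \<open>
  Expanding all crossings of a planar 3-tangle leaves closed loops and one of the five noncrossing
  matchings of its endpoints. The half turn exchanges \<open>a\<^sub>1 = (12)(34)(56)\<close> and
  \<open>a\<^sub>2 = (16)(23)(45)\<close> and fixes the other three matchings, and each of those closes up to two
  circles with \<open>a\<^sub>1\<close> as well as with \<open>a\<^sub>2\<close>. So both differences of brackets contain only the coefficient
  difference \<open>X\<close> of \<open>a\<^sub>1\<close> and \<open>a\<^sub>2\<close> in \<open>T\<close>: with \<open>\<delta>\<close> the value of a loop and \<open>Y\<close> the coefficient
  difference of \<open>T'\<close>, they are \<open>(\<delta>\<^sup>2 - 1) X\<close> and \<open>- (\<delta>\<^sup>2 - 1) X Y\<close>. The writhes contribute units,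
  because rotation and reversal of all strands preserve every crossing sign.

  That the matchings are noncrossing follows from the Euler characteristic by counting: over the
  field with two elements, genus 0 forces every cycle of edges to be the boundary of a set of faces.
\<close>

section \<open>Counting classes of generated equivalence relations\<close>

text \<open>Noncrossing is essential for the algebra: the crossing matching (13)(24)(56) closes to
  two circles with a1 but to one circle with a2, and \<delta> - 1 is not a multiple of \<delta>^2 -
  1. But \<open>planar\<close> is a single numerical equation about \<open>T\<close>, without curves
  or regions. Sets of darts under symmetric difference therefore serve as vector spaces over the
  field with two elements; a space of dimension d has 2^d elements, so ranks are compared through
  cardinalities, and the Euler equation says that boundaries are as numerous as cycles. Smoothed
  diagrams are never shown to be planar. Both smoothings of a crossing join darts that are
  neighbours around it, so a strand of any state, closed up through the boundary vertex, is already
  a cycle of the unsmoothed map, and the one equation for \<open>T\<close> serves all its states.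
  The divisibility needs no factorization theory: the double sum over the states of \<open>T\<close>
  and \<open>T'\<close> splits into a product, which exhibits the quotient.\<close>

definition gen :: "('a \<times> 'a) set \<Rightarrow> ('a \<times> 'a) set" where
  "gen R = (R \<union> R\<inverse>)\<^sup>*"

lemma gen_refl [simp]: "(x, x) \<in> gen R"
  by (simp add: gen_def)

lemma gen_sym: "(x, y) \<in> gen R \<Longrightarrow> (y, x) \<in> gen R"
  unfolding gen_def by (metis converse_Un converse_converse rtrancl_converseI sup_commute)

lemma gen_trans: "(x, y) \<in> gen R \<Longrightarrow> (y, z) \<in> gen R \<Longrightarrow> (x, z) \<in> gen R"
  unfolding gen_def by (rule rtrancl_trans)

lemma gen_base: "(x, y) \<in> R \<Longrightarrow> (x, y) \<in> gen R"
  unfolding gen_def by auto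

lemma gen_map:
  assumes "(x, y) \<in> gen R" and "\<And>a b. (a, b) \<in> R \<Longrightarrow> (f a, f b) \<in> gen S"
  shows "(f x, f y) \<in> gen S"
  using assms(1) unfolding gen_def
proof (induction rule: rtrancl_induct)
  case base
  then show ?case by simp
next
  case (step y z)
  have "(f y, f z) \<in> gen S"
    using step.hyps(2)
  proof
    assume "(y, z) \<in> R" then show ?thesis by (rule assms(2))
  next
    assume "(y, z) \<in> R\<inverse>" then show ?thesis by (intro gen_sym[OF assms(2)]) simp
  qed
  with step.IH show ?case by (fold gen_def) (rule gen_trans)
qed

lemma gen_invariant:
  assumes "(x, y) \<in> gen R" and "\<And>a b. (a, b) \<in> R \<Longrightarrow> f a = f b"
  shows "f x = f y"
  using assms(1) unfolding gen_def
proof (induction rule: rtrancl_induct)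
  case base
  then show ?case by simp
next
  case (step y z)
  have "f y = f z"
    using step.hyps(2)
  proof
    assume "(y, z) \<in> R" then show ?thesis by (rule assms(2))
  next
    assume "(y, z) \<in> R\<inverse>" then show ?thesis by (intro assms(2)[symmetric]) simp
  qed
  with step.IH show ?case by simp
qed

abbreviation classes :: "'a set \<Rightarrow> ('a \<times> 'a) set \<Rightarrow> 'a set set" where
  "classes H R \<equiv> H // {(x, y). x \<in> H \<and> y \<in> H \<and> (x, y) \<in> gen R}"

lemma num_classes_gen: "num_classes H R = card (classes H R)"
  by (simp add: num_classes_def gen_def)

lemma equiv_gen: "equiv H {(x, y). x \<in> H \<and> y \<in> H \<and> (x, y) \<in> gen R}"
  by (intro equivI refl_onI symI transI) (auto dest: gen_sym gen_trans)

lemma mem_classes_iff: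
  "c \<in> classes H R \<longleftrightarrow> (\<exists>x\<in>H. c = {y \<in> H. (x, y) \<in> gen R})"
  by (auto simp: quotient_def)

text \<open>Counting by a complete invariant: \<open>f\<close> need not choose representatives and
  may take values of any type, which is what the count of circles after gluing uses.\<close>

lemma num_classes_eqI:
  assumes "\<And>x y. x \<in> H \<Longrightarrow> y \<in> H \<Longrightarrow> f x = f y \<longleftrightarrow> (x, y) \<in> gen R"
  shows "num_classes H R = card (f ` H)"
proof -
  have "classes H R = (\<lambda>v. {y \<in> H. f y = v}) ` f ` H"
  proof -
    have "{y \<in> H. (x, y) \<in> gen R} = {y \<in> H. f y = f x}" if "x \<in> H" for x
      using that assms by (metis (no_types, lifting))
    then show ?thesis by (force simp: mem_classes_iff)
  qed
  moreover have "inj_on (\<lambda>v. {y \<in> H. f y = v}) (f ` H)"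
    by (auto simp: inj_on_def)
  ultimately show ?thesis
    by (simp add: num_classes_gen card_image)
qed

text \<open>A nonempty block that is disjoint from the others is recovered from any of its points,
  so a union determines its blocks. This turns a number of blocks into the exponent of a power of
  two.\<close>

lemma card_unions:
  assumes "finite P" "disjoint P" "{} \<notin> P"
  shows "card {\<Union>Q |Q. Q \<subseteq> P} = 2 ^ card P"
proof -
  have "inj_on Union (Pow P)"
  proof (rule inj_onI)
    fix Q Q' assume Q: "Q \<in> Pow P" "Q' \<in> Pow P" "\<Union>Q = \<Union>Q'"
    have le: "A \<subseteq> B" if A: "A \<in> Pow P" and B: "B \<in> Pow P" and "\<Union>A = \<Union>B" for A B
    proof
      fix c assume "c \<in> A"
      then have "c \<noteq> {}" using A assms(3) by blast
      then obtain x where "x \<in> c" by blast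
      then obtain c' where "c' \<in> B" "x \<in> c'" using \<open>c \<in> A\<close> \<open>\<Union>A = \<Union>B\<close> by blast
      then have "c = c'"
        using A B \<open>c \<in> A\<close> \<open>x \<in> c\<close> disjointD[OF assms(2), of c c'] by blast
      then show "c \<in> B" using \<open>c' \<in> B\<close> by simp
    qed
    show "Q = Q'" using le[OF Q] le[OF Q(2,1) Q(3)[symmetric]] by (rule equalityI)
  qed
  moreover have "{\<Union>Q |Q. Q \<subseteq> P} = Union ` Pow P" by auto
  ultimately show ?thesis
    using assms(1) by (simp add: card_image card_Pow)
qed

text \<open>The indicator functions that are constant along \<open>R\<close>: a vector space over
  the field with two elements with one coordinate per class. Replacing the number of classes by the
  size of this space makes linear algebra available.\<close>

definition saturated :: "'a set \<Rightarrow> ('a \<times> 'a) set \<Rightarrow> 'a set set" where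
  "saturated H R = {X. X \<subseteq> H \<and> (\<forall>(x, y)\<in>R. x \<in> X \<longleftrightarrow> y \<in> X)}"

lemma card_saturated:
  assumes "finite H" "R \<subseteq> H \<times> H"
  shows "card (saturated H R) = 2 ^ num_classes H R"
proof -
  have "saturated H R = {\<Union>Q |Q. Q \<subseteq> classes H R}" (is "_ = ?B")
  proof (intro equalityI subsetI)
    fix X assume X: "X \<in> saturated H R"
    have "X \<subseteq> H" using X by (auto simp: saturated_def)
    have sat: "x \<in> X \<longleftrightarrow> y \<in> X" if "(x, y) \<in> gen R" for x y
      using that by (rule gen_invariant) (use X in \<open>auto simp: saturated_def\<close>)
    have "X = (\<Union>x\<in>X. {y \<in> H. (x, y) \<in> gen R})"
      using \<open>X \<subseteq> H\<close> sat by auto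
    moreover have "(\<lambda>x. {y \<in> H. (x, y) \<in> gen R}) ` X \<subseteq> classes H R"
    proof
      fix c assume "c \<in> (\<lambda>x. {y \<in> H. (x, y) \<in> gen R}) ` X"
      then obtain x where "x \<in> X" "c = {y \<in> H. (x, y) \<in> gen R}" by (rule imageE)
      then show "c \<in> classes H R" unfolding mem_classes_iff using \<open>X \<subseteq> H\<close> by (intro bexI[of _ x]) auto
    qed
    ultimately have "\<exists>Q. X = \<Union>Q \<and> Q \<subseteq> classes H R" by (intro exI conjI)
    then show "X \<in> ?B" by simp
  next
    fix X assume "X \<in> ?B"
    then obtain Q where Q: "X = \<Union>Q" "Q \<subseteq> classes H R" by blast
    have "x \<in> c \<longleftrightarrow> y \<in> c" if xy: "(x, y) \<in> R" and "c \<in> Q" for x y c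
    proof -
      have "c \<in> classes H R" using \<open>c \<in> Q\<close> Q(2) by blast
      then obtain z where c: "c = {y \<in> H. (z, y) \<in> gen R}"
        unfolding mem_classes_iff by blast
      have "x \<in> H" "y \<in> H" using xy assms(2) by auto
      moreover have "(z, x) \<in> gen R \<longleftrightarrow> (z, y) \<in> gen R"
        using gen_base[OF xy] gen_sym[OF gen_base[OF xy]] by (metis gen_trans)
      ultimately show ?thesis by (simp add: c)
    qed
    then have "\<forall>(x, y)\<in>R. x \<in> X \<longleftrightarrow> y \<in> X" by (auto simp: Q(1))
    moreover have "X \<subseteq> H" using Q by (auto simp: subset_eq mem_classes_iff)
    ultimately show "X \<in> saturated H R" by (simp add: saturated_def)
  qed
  moreover have "disjoint (classes H R)"
    using quotient_disj[OF equiv_gen[of H R]] by (auto simp: disjoint_def)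
  moreover have "{} \<notin> classes H R" by (auto simp: mem_classes_iff)
  moreover have "finite (classes H R)" using assms(1) by (simp add: quotient_def)
  ultimately show ?thesis
    by (simp add: num_classes_gen card_unions)
qed

section \<open>Cycles of planar maps\<close>

text \<open>The linear subspaces of a power set over the field with two elements, with symmetric
  difference as addition.\<close>

definition sym_diff_closed :: "'a set set \<Rightarrow> bool" where
  "sym_diff_closed A \<longleftrightarrow> {} \<in> A \<and> (\<forall>X\<in>A. \<forall>Y\<in>A. sym_diff X Y \<in> A)"

lemma sym_diff_closed_saturated: "sym_diff_closed (saturated H R)"
  by (auto simp: sym_diff_closed_def saturated_def)

lemma bij_betw_sym_diff:
  assumes "sym_diff_closed A" "X \<in> A"
  shows "bij_betw (sym_diff X) A A"
  by (rule bij_betw_byWitness[where f' = "sym_diff X"])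
    (use assms in \<open>auto simp: sym_diff_closed_def\<close>)

text \<open>Rank and nullity in multiplicative form: translation by a preimage \<open>X0\<close> of
  a value carries the fibre over it onto the kernel, so all fibres have the same size.\<close>

lemma card_kernel_image:
  assumes "finite A" "sym_diff_closed A"
    and add: "\<And>X Y. X \<in> A \<Longrightarrow> Y \<in> A \<Longrightarrow> f (sym_diff X Y) = sym_diff (f X) (f Y)"
  shows "card A = card (f ` A) * card {X \<in> A. f X = {}}"
proof -
  have "card {X \<in> A. f X = y} = card {X \<in> A. f X = {}}" if "y \<in> f ` A" for y
  proof -
    obtain X0 where X0: "X0 \<in> A" "y = f X0" using \<open>y \<in> f ` A\<close> by blast
    have "bij_betw (sym_diff X0) {X \<in> A. f X = y} {X \<in> A. f X = {}}"
      by (rule bij_betw_byWitness[where f' = "sym_diff X0"])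
        (use X0 assms(2) in \<open>auto simp: add sym_diff_closed_def\<close>)
    then show ?thesis by (rule bij_betw_same_card)
  qed
  moreover have "card A = (\<Sum>y\<in>f ` A. card {X \<in> A. f X = y})"
    using sum.image_gen[OF assms(1), of "\<lambda>_. 1::nat" f] by simp
  ultimately show ?thesis by simp
qed

text \<open>The parity of \<open>card (X \<inter> Y)\<close> serves below as the scalar product; its
  additivity rests on this.\<close>

lemma even_card_sym_diff:
  assumes "finite X" "finite Y"
  shows "even (card (sym_diff X Y)) \<longleftrightarrow> (even (card X) \<longleftrightarrow> even (card Y))"
proof -
  have "card X = card (X - Y) + card (X \<inter> Y)" "card Y = card (Y - X) + card (X \<inter> Y)"
    using assms by (metis card_Diff_subset_Int card_Int_Diff add.commute finite_Int Int_commute)+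
  moreover have "card (sym_diff X Y) = card (X - Y) + card (Y - X)"
    using assms by (intro card_Un_disjoint) auto
  ultimately show ?thesis by auto
qed

text \<open>Orthogonality of characters: if some \<open>X0\<close> meets \<open>Y\<close> in an odd
  number of points, translation by \<open>X0\<close> permutes \<open>A\<close> and changes every
  sign, so the sum equals its own negative.\<close>

lemma character_sum:
  assumes "finite A" "sym_diff_closed A" "\<And>X. X \<in> A \<Longrightarrow> finite X"
  shows "(\<Sum>X\<in>A. (-1::int) ^ card (X \<inter> Y)) =
    (if \<forall>X\<in>A. even (card (X \<inter> Y)) then int (card A) else 0)"
proof (cases "\<forall>X\<in>A. even (card (X \<inter> Y))")
  case True
  then show ?thesis by simp
next
  case False
  then obtain X0 where X0: "X0 \<in> A" "odd (card (X0 \<inter> Y))" by blast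
  have eq: "(-1::int) ^ card (sym_diff X0 X \<inter> Y) = - ((-1) ^ card (X \<inter> Y))" if "X \<in> A" for X
  proof -
    have "sym_diff X0 X \<inter> Y = sym_diff (X0 \<inter> Y) (X \<inter> Y)" by auto
    moreover have "finite (X0 \<inter> Y)" "finite (X \<inter> Y)" using assms(3) X0(1) that by auto
    ultimately have "even (card (sym_diff X0 X \<inter> Y)) \<longleftrightarrow> odd (card (X \<inter> Y))"
      using X0(2) even_card_sym_diff by (metis (no_types, lifting))
    then show ?thesis by (simp add: minus_one_power_iff)
  qed
  have "(\<Sum>X\<in>A. (-1::int) ^ card (X \<inter> Y)) = (\<Sum>X\<in>A. (-1::int) ^ card (sym_diff X0 X \<inter> Y))"
    by (rule sum.reindex_bij_betw[OF bij_betw_sym_diff[OF assms(2) X0(1)], symmetric])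
  also have "\<dots> = - (\<Sum>X\<in>A. (-1::int) ^ card (X \<inter> Y))"
    by (simp add: eq sum_negf)
  finally have "(\<Sum>X\<in>A. (-1::int) ^ card (X \<inter> Y)) = 0" by simp
  then show ?thesis by (simp only: False if_False)
qed

text \<open>Equality of row rank and column rank over the field with two elements.\<close>

lemma card_orthogonal:
  assumes "finite H" "A \<subseteq> Pow H" "B \<subseteq> Pow H" "sym_diff_closed A" "sym_diff_closed B"
  shows "card B * card {X \<in> A. \<forall>Y\<in>B. even (card (Y \<inter> X))} =
    card A * card {Y \<in> B. \<forall>X\<in>A. even (card (X \<inter> Y))}"
proof -
  have fin: "finite A" "finite B"
    using assms(1-3) by (auto intro: finite_subset)
  have fin': "finite X" if "X \<in> A \<union> B" for X
    using that assms(1-3) by (auto intro: finite_subset)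
  \<comment> \<open>Double counting of signs over \<open>A\<close> and \<open>B\<close>: in either
    order, the inner sum is nonzero only for those sets that are orthogonal to the whole other
    space.\<close>
  have "(\<Sum>X\<in>A. \<Sum>Y\<in>B. (-1::int) ^ card (Y \<inter> X)) =
      (\<Sum>X\<in>A. if \<forall>Y\<in>B. even (card (Y \<inter> X)) then int (card B) else 0)"
    using fin fin' assms by (intro sum.cong refl character_sum) auto
  also have "\<dots> = int (card B * card {X \<in> A. \<forall>Y\<in>B. even (card (Y \<inter> X))})"
    using fin by (simp add: sum.If_cases Int_def mult.commute)
  finally have 1: "(\<Sum>X\<in>A. \<Sum>Y\<in>B. (-1::int) ^ card (Y \<inter> X)) = \<dots>" .
  have "(\<Sum>Y\<in>B. \<Sum>X\<in>A. (-1::int) ^ card (X \<inter> Y)) =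
      (\<Sum>Y\<in>B. if \<forall>X\<in>A. even (card (X \<inter> Y)) then int (card A) else 0)"
    using fin fin' assms by (intro sum.cong refl character_sum) auto
  also have "\<dots> = int (card A * card {Y \<in> B. \<forall>X\<in>A. even (card (X \<inter> Y))})"
    using fin by (simp add: sum.If_cases Int_def mult.commute)
  finally have 2: "(\<Sum>Y\<in>B. \<Sum>X\<in>A. (-1::int) ^ card (X \<inter> Y)) = \<dots>" .
  have "(\<Sum>X\<in>A. \<Sum>Y\<in>B. (-1::int) ^ card (Y \<inter> X)) = (\<Sum>Y\<in>B. \<Sum>X\<in>A. (-1::int) ^ card (X \<inter> Y))"
    by (subst sum.swap) (simp add: Int_commute)
  then show ?thesis unfolding 1 2 by (simp only: of_nat_eq_iff)
qed

section \<open>Pairings and their involutions\<close>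

definition pairing :: "'a set set \<Rightarrow> bool" where
  "pairing P \<longleftrightarrow> disjoint P \<and> (\<forall>e\<in>P. card e = 2)"

text \<open>Identity off the pairing, which makes it an involution of the whole type. For the joints
  of a crossingless tangle, the fixed points among the darts are exactly the endpoints.\<close>

definition mate :: "'a set set \<Rightarrow> 'a \<Rightarrow> 'a" where
  "mate P x = (if x \<in> \<Union>P then THE y. {x, y} \<in> P else x)"

lemma mate_eqI:
  assumes "pairing P" "{x, y} \<in> P"
  shows "mate P x = y"
proof -
  have "z = y" if "{x, z} \<in> P" for z
  proof -
    have "{x, z} = {x, y}"
    proof (rule ccontr)
      assume "{x, z} \<noteq> {x, y}"
      then have "{x, z} \<inter> {x, y} = {}"
        using disjointD that assms by (metis pairing_def)
      then show False by blast
    qed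
    then show ?thesis by (auto simp: doubleton_eq_iff)
  qed
  then have "(THE y. {x, y} \<in> P) = y"
    using assms(2) by blast
  then show ?thesis
    using assms(2) by (auto simp: mate_def)
qed

lemma mate_edge:
  assumes "pairing P" "x \<in> \<Union>P"
  shows "{x, mate P x} \<in> P" "mate P x \<noteq> x"
proof -
  obtain e where e: "e \<in> P" "x \<in> e" using assms(2) by blast
  moreover have "card e = 2" using e assms(1) by (simp add: pairing_def)
  ultimately obtain y where "e = {x, y}" "x \<noteq> y"
    by (auto simp: card_2_iff)
  then show "{x, mate P x} \<in> P" "mate P x \<noteq> x"
    using e mate_eqI[OF assms(1)] by auto
qed

lemma pairing_unique:
  assumes "pairing P" "e \<in> P" "x \<in> e"
  shows "e = {x, mate P x}"
proof (rule ccontr)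
  assume "e \<noteq> {x, mate P x}"
  moreover have "{x, mate P x} \<in> P" using assms by (intro mate_edge(1)) auto
  ultimately have "e \<inter> {x, mate P x} = {}"
    using assms(1,2) by (intro disjointD) (simp_all add: pairing_def)
  then show False using assms(3) by blast
qed

lemma mate_outside: "x \<notin> \<Union>P \<Longrightarrow> mate P x = x"
  by (simp add: mate_def)

lemma mate_mem: "pairing P \<Longrightarrow> x \<in> \<Union>P \<Longrightarrow> mate P x \<in> \<Union>P"
  using mate_edge(1)[of P x] by blast

lemma mate_mate:
  assumes "pairing P"
  shows "mate P (mate P x) = x"
proof (cases "x \<in> \<Union>P")
  case True
  then show ?thesis
    using mate_edge(1)[OF assms True] by (intro mate_eqI[OF assms]) (simp add: insert_commute)
qed (simp add: mate_outside)

lemma pair_iff_mate: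
  assumes "pairing P"
  shows "{x, y} \<in> P \<longleftrightarrow> x \<in> \<Union>P \<and> y = mate P x"
proof
  assume "{x, y} \<in> P"
  then show "x \<in> \<Union>P \<and> y = mate P x" using mate_eqI[OF assms] by auto
next
  assume "x \<in> \<Union>P \<and> y = mate P x"
  then show "{x, y} \<in> P" using mate_edge(1)[OF assms] by simp
qed

lemma even_card_mate:
  assumes "pairing P" "finite X" "X \<subseteq> \<Union>P" "\<And>x. x \<in> X \<Longrightarrow> mate P x \<in> X"
  shows "even (card X)"
proof -
  let ?Q = "{e \<in> P. e \<subseteq> X}"
  have "X = \<Union>?Q"
  proof (intro equalityI subsetI)
    fix x assume "x \<in> X"
    then have "{x, mate P x} \<in> ?Q" using assms mate_edge(1)[OF assms(1)] by blast
    then show "x \<in> \<Union>?Q" by blast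
  qed auto
  moreover have "card (\<Union>?Q) = (\<Sum>e\<in>?Q. card e)"
    using assms(1,2) by (intro card_Union_disjoint) (auto simp: pairing_def disjoint_def pairwise_def disjnt_def intro: finite_subset)
  moreover have "\<dots> = (\<Sum>e\<in>?Q. 2)"
    using assms(1) by (intro sum.cong) (auto simp: pairing_def)
  ultimately have "card X = 2 * card ?Q" by simp
  then show ?thesis by simp
qed

text \<open>
  Saturated sets of darts play the role of chains: for the face relation \<open>R O N\<close> they are the
  2-chains, for \<open>R\<close> the 1-chains, for \<open>N\<close> the 0-chains, and \<open>C\<close> is a 2-chain with boundary \<open>K\<close>.
\<close>

lemma planar_cycle_bounds:
  fixes E :: "'a set set" and \<sigma> :: "'a \<Rightarrow> 'a" and K :: "'a set"
  defines "H \<equiv> \<Union>E" and "N \<equiv> {(x, \<sigma> x) |x. x \<in> \<Union>E}" and "R \<equiv> {(x, y). {x, y} \<in> E}"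
  assumes fin: "finite H" and E: "pairing E" and \<sigma>: "bij_betw \<sigma> H H"
    and euler: "num_classes H N + num_classes H (R O N) = card E + 2 * num_classes H (R \<union> N)"
    and K: "K \<subseteq> H" "\<And>x. x \<in> K \<Longrightarrow> mate E x \<in> K"
    and cycle: "\<And>Y. Y \<in> saturated H N \<Longrightarrow> even (card (Y \<inter> K))"
  obtains C where "\<And>x. x \<in> H \<Longrightarrow> x \<in> C \<longleftrightarrow> \<sigma> (mate E x) \<in> C"
    and "\<And>x. x \<in> H \<Longrightarrow> x \<in> K \<longleftrightarrow> (x \<in> C) \<noteq> (\<sigma> x \<in> C)"
proof -
  let ?\<epsilon> = "mate E"
  have R: "R = (\<lambda>x. (x, ?\<epsilon> x)) ` H"
    by (auto simp: R_def H_def pair_iff_mate[OF E])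
  have N: "N = (\<lambda>x. (x, \<sigma> x)) ` H"
    by (auto simp: N_def H_def)
  have \<epsilon>: "?\<epsilon> x \<in> H" if "x \<in> H" for x
    using mate_mem[OF E] that by (simp add: H_def)
  have \<sigma>H: "\<sigma> x \<in> H" if "x \<in> H" for x
    using \<sigma> that by (auto simp: bij_betw_def)
  have sub: "R \<subseteq> H \<times> H" "N \<subseteq> H \<times> H" "R O N \<subseteq> H \<times> H" "R \<union> N \<subseteq> H \<times> H"
    using R N \<epsilon> \<sigma>H by auto
  have satE: "X \<in> saturated H R \<longleftrightarrow> X \<subseteq> H \<and> (\<forall>x\<in>H. x \<in> X \<longleftrightarrow> ?\<epsilon> x \<in> X)" for X
    using R by (simp add: saturated_def)
  have satV: "X \<in> saturated H N \<longleftrightarrow> X \<subseteq> H \<and> (\<forall>x\<in>H. x \<in> X \<longleftrightarrow> \<sigma> x \<in> X)" for X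
    using N by (simp add: saturated_def)
  have satF: "X \<in> saturated H (R O N) \<longleftrightarrow> X \<subseteq> H \<and> (\<forall>x\<in>H. x \<in> X \<longleftrightarrow> \<sigma> (?\<epsilon> x) \<in> X)" for X
  proof -
    have "R O N = (\<lambda>x. (x, \<sigma> (?\<epsilon> x))) ` H"
      using \<epsilon> by (auto simp: R N)
    then show ?thesis by (simp add: saturated_def)
  qed
  have satC: "X \<in> saturated H (R \<union> N) \<longleftrightarrow> X \<in> saturated H R \<and> X \<in> saturated H N" for X
    by (auto simp: saturated_def)
  have powH: "saturated H S \<subseteq> Pow H" for S by (auto simp: saturated_def)
  have finS: "finite (saturated H S)" for S
    using powH fin by (meson finite_Pow_iff finite_subset)
  have evenE: "even (card X)" if "X \<in> saturated H R" for X
  proof (rule even_card_mate[OF E])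
    show "finite X" using that fin by (auto simp: satE intro: finite_subset)
    show "X \<subseteq> \<Union>E" using that by (simp add: satE flip: H_def)
    show "?\<epsilon> x \<in> X" if "x \<in> X" for x
      using that \<open>X \<in> saturated H R\<close> by (auto simp: satE)
  qed

  \<comment> \<open>The 1-chains are the unions of edges, so their space has dimension
    \<open>card E\<close>.\<close>
  have "saturated H R = {\<Union>Q |Q. Q \<subseteq> E}"
  proof (intro equalityI subsetI)
    fix X assume X: "X \<in> saturated H R"
    have "X = \<Union>{e \<in> E. e \<subseteq> X}"
    proof (intro equalityI subsetI)
      fix x assume "x \<in> X"
      moreover from this have "x \<in> H" using X by (auto simp: satE)
      ultimately have "{x, ?\<epsilon> x} \<in> {e \<in> E. e \<subseteq> X}"
        using X mate_edge(1)[OF E, of x] \<open>x \<in> X\<close> by (auto simp: satE simp flip: H_def)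
      then show "x \<in> \<Union>{e \<in> E. e \<subseteq> X}" by blast
    qed auto
    then show "X \<in> {\<Union>Q |Q. Q \<subseteq> E}" by blast
  next
    fix X assume "X \<in> {\<Union>Q |Q. Q \<subseteq> E}"
    then obtain Q where Q: "X = \<Union>Q" "Q \<subseteq> E" by blast
    have "?\<epsilon> x \<in> X" if "x \<in> X" for x
    proof -
      obtain e where e: "e \<in> Q" "x \<in> e" using \<open>x \<in> X\<close> Q(1) by blast
      moreover have x: "x \<in> \<Union>E" using e Q(2) by blast
      ultimately have "e = {x, ?\<epsilon> x}"
        using Q(2) pairing_unique[OF E] by blast
      then show ?thesis using e Q(1) by blast
    qed
    then show "X \<in> saturated H R"
      unfolding satE using Q mate_mate[OF E] by (metis H_def Union_mono)
  qed
  moreover have "finite E" using fin unfolding H_def by (rule finite_UnionD)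
  moreover have "{} \<notin> E" "disjoint E" using E by (auto simp: pairing_def)
  ultimately have cardE: "card (saturated H R) = 2 ^ card E"
    by (simp add: card_unions)

  \<comment> \<open>The cycles: edge sets that meet every vertex in an even number of darts. The
    0-chains orthogonal to all 1-chains are the unions of components, so the space of cycles has
    dimension \<open>card E\<close> - V + c, with V vertices and c components.\<close>
  define Z where "Z = {X \<in> saturated H R. \<forall>Y\<in>saturated H N. even (card (Y \<inter> X))}"
  have "{Y \<in> saturated H N. \<forall>X\<in>saturated H R. even (card (X \<inter> Y))} = saturated H (R \<union> N)"
  proof (intro equalityI subsetI)
    fix Y assume Y: "Y \<in> {Y \<in> saturated H N. \<forall>X\<in>saturated H R. even (card (X \<inter> Y))}"
    have "x \<in> Y \<longleftrightarrow> ?\<epsilon> x \<in> Y" if "x \<in> H" for x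
    proof -
      have "{x, ?\<epsilon> x} \<in> saturated H R"
        using that \<epsilon> mate_mate[OF E] by (auto simp: satE) metis
      then have "even (card ({x, ?\<epsilon> x} \<inter> Y))" using Y by blast
      moreover have "x \<noteq> ?\<epsilon> x" using mate_edge(2)[OF E, of x] that by (auto simp: H_def)
      ultimately show ?thesis by (cases "x \<in> Y"; cases "?\<epsilon> x \<in> Y") auto
    qed
    then show "Y \<in> saturated H (R \<union> N)"
      using Y by (simp add: satC satE satV)
  next
    fix Y assume Y: "Y \<in> saturated H (R \<union> N)"
    have "even (card (X \<inter> Y))" if "X \<in> saturated H R" for X
      by (rule evenE) (use that Y in \<open>auto simp: satC satE\<close>)
    then show "Y \<in> {Y \<in> saturated H N. \<forall>X\<in>saturated H R. even (card (X \<inter> Y))}"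
      using Y by (simp add: satC)
  qed
  then have cardZ: "2 ^ num_classes H N * card Z = 2 ^ card E * 2 ^ num_classes H (R \<union> N)"
    using card_orthogonal[OF fin powH powH sym_diff_closed_saturated sym_diff_closed_saturated, of R N]
      card_saturated[OF fin sub(2)] card_saturated[OF fin sub(4)]
    by (simp add: Z_def cardE)

  \<comment> \<open>A dart and its mate lie on the two sides of their edge; the edge is in the
    boundary when exactly one side belongs to \<open>X\<close>. The kernel consists of unions of
    components, so the boundaries have dimension F - c for F faces.\<close>
  define bd where "bd X = {x \<in> H. (x \<in> X) \<noteq> (?\<epsilon> x \<in> X)}" for X
  have kernel: "{X \<in> saturated H (R O N). bd X = {}} = saturated H (R \<union> N)"
  proof (intro equalityI subsetI)
    fix X assume "X \<in> {X \<in> saturated H (R O N). bd X = {}}"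
    then have X: "X \<subseteq> H" "\<And>x. x \<in> H \<Longrightarrow> x \<in> X \<longleftrightarrow> \<sigma> (?\<epsilon> x) \<in> X" "\<And>x. x \<in> H \<Longrightarrow> x \<in> X \<longleftrightarrow> ?\<epsilon> x \<in> X"
      by (auto simp: satF bd_def)
    have "x \<in> X \<longleftrightarrow> \<sigma> x \<in> X" if "x \<in> H" for x
      using X(2)[OF \<epsilon>[OF that]] X(3)[OF that] by (simp add: mate_mate[OF E])
    then show "X \<in> saturated H (R \<union> N)"
      using X by (simp add: satC satE satV)
  next
    fix X assume X: "X \<in> saturated H (R \<union> N)"
    then show "X \<in> {X \<in> saturated H (R O N). bd X = {}}"
      using \<epsilon> unfolding satC satE satV satF bd_def by blast
  qed
  have "bd (sym_diff X Y) = sym_diff (bd X) (bd Y)" for X Y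
    by (auto simp: bd_def)
  then have "card (saturated H (R O N)) = card (bd ` saturated H (R O N)) * card (saturated H (R \<union> N))"
    unfolding kernel[symmetric] by (intro card_kernel_image finS sym_diff_closed_saturated)
  then have card_bd: "2 ^ num_classes H (R O N) = card (bd ` saturated H (R O N)) * 2 ^ num_classes H (R \<union> N)"
    by (simp add: card_saturated[OF fin] sub)

  \<comment> \<open>Face invariance at the mate of \<open>x\<close> puts \<open>\<sigma> x\<close>
    and \<open>?\<epsilon> x\<close> on the same side. So the boundary can be read off from
    consecutive darts at a vertex.\<close>
  have turn: "\<sigma> x \<in> X \<longleftrightarrow> ?\<epsilon> x \<in> X" if "X \<in> saturated H (R O N)" "x \<in> H" for x X
    using that \<epsilon> mate_mate[OF E] by (metis satF)
  have "bd ` saturated H (R O N) \<subseteq> Z"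
  proof (intro image_subsetI)
    fix X assume X: "X \<in> saturated H (R O N)"
    have "bd X \<in> saturated H R"
      using \<epsilon> mate_mate[OF E] by (auto simp: satE bd_def)
    moreover have "even (card (Y \<inter> bd X))" if Y: "Y \<in> saturated H N" for Y
    proof -
      have YH: "Y \<subseteq> H" using Y by (simp add: satV)
      \<comment> \<open>\<open>\<sigma>\<close> permutes the darts of the vertices in
        \<open>Y\<close>, so \<open>Y \<inter> bd X\<close> is the symmetric difference of two sets
        of equal size: boundaries have even degree.\<close>
      have "bij_betw \<sigma> {x \<in> Y. \<sigma> x \<in> X} (Y \<inter> X)"
      proof (rule bij_betw_imageI)
        show "inj_on \<sigma> {x \<in> Y. \<sigma> x \<in> X}"
          using \<sigma> YH by (auto simp: bij_betw_def intro: inj_on_subset)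
        show "\<sigma> ` {x \<in> Y. \<sigma> x \<in> X} = Y \<inter> X"
        proof (intro equalityI subsetI)
          fix y assume "y \<in> Y \<inter> X"
          moreover from this obtain x where "x \<in> H" "y = \<sigma> x"
            using \<sigma> YH by (auto simp: bij_betw_def)
          ultimately show "y \<in> \<sigma> ` {x \<in> Y. \<sigma> x \<in> X}" using Y by (auto simp: satV)
        qed (use Y YH in \<open>auto simp: satV\<close>)
      qed
      then have "card {x \<in> Y. \<sigma> x \<in> X} = card (Y \<inter> X)" by (rule bij_betw_same_card)
      moreover have "Y \<inter> bd X = sym_diff {x \<in> Y. \<sigma> x \<in> X} (Y \<inter> X)"
        using YH turn[OF X] by (auto simp: bd_def)
      moreover have "finite Y" using YH fin by (rule finite_subset)
      ultimately show ?thesis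
        using even_card_sym_diff[of "{x \<in> Y. \<sigma> x \<in> X}" "Y \<inter> X"] by simp
    qed
    ultimately show "bd X \<in> Z" by (simp add: Z_def)
  qed
  moreover have "card (bd ` saturated H (R O N)) = card Z"
  proof -
    let ?V = "2 ^ num_classes H N :: nat" and ?C = "2 ^ num_classes H (R \<union> N) :: nat"
    \<comment> \<open>The Euler equation reads F - c = \<open>card E\<close> - V + c, so boundaries
      and cycles are equally numerous; multiplying out the powers of two avoids subtraction.\<close>
    have "?V * ?C * card (bd ` saturated H (R O N)) = 2 ^ (num_classes H N + num_classes H (R O N))"
      by (simp add: power_add card_bd)
    also have "\<dots> = ?C * (2 ^ card E * ?C)"
      unfolding euler by (simp add: power_add mult_2)
    also have "\<dots> = ?V * ?C * card Z"
      unfolding cardZ[symmetric] by simp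
    finally show ?thesis by simp
  qed
  moreover have "finite Z" unfolding Z_def using finS by simp
  ultimately have "bd ` saturated H (R O N) = Z"
    by (intro card_subset_eq)
  moreover have "K \<in> Z"
    using K cycle mate_mate[OF E] by (auto simp: Z_def satE) metis
  ultimately obtain C where C: "C \<in> saturated H (R O N)" "K = bd C" by blast
  show thesis
  proof (rule that)
    show "x \<in> C \<longleftrightarrow> \<sigma> (?\<epsilon> x) \<in> C" if "x \<in> H" for x
      using C(1) that by (simp add: satF)
    show "x \<in> K \<longleftrightarrow> (x \<in> C) \<noteq> (\<sigma> x \<in> C)" if "x \<in> H" for x
      using turn[OF C(1) that] that by (simp add: C(2) bd_def)
  qed
qed

section \<open>Strands of smoothed tangles\<close>

text \<open>
  The orbit of \<open>p\<close> under the two involutions is a single cycle \<open>a 0, \<dots>, a (N - 1)\<close> of their product,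
  on which both act as reflections; the reflection fixing \<open>a 0\<close> also fixes exactly \<open>a (N / 2)\<close>.
\<close>

lemma involution_pair_orbit:
  assumes E: "pairing E" and J: "pairing J" and fin: "finite (\<Union>E)" and sub: "\<Union>J \<subseteq> \<Union>E"
    and p: "p \<in> \<Union>E - \<Union>J"
  defines "R \<equiv> {(x, y). {x, y} \<in> E} \<union> {(x, y). {x, y} \<in> J}"
  shows "\<exists>!q. q \<in> \<Union>E - \<Union>J \<and> q \<noteq> p \<and> (p, q) \<in> gen R"
proof -
  let ?\<epsilon> = "mate E" and ?\<tau> = "mate J"
  have \<epsilon>\<epsilon>: "?\<epsilon> (?\<epsilon> x) = x" and \<tau>\<tau>: "?\<tau> (?\<tau> x) = x" for x
    using mate_mate[OF E] mate_mate[OF J] by simp_all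
  have \<tau>p: "?\<tau> p = p" using p by (intro mate_outside) auto
  have \<epsilon>H: "?\<epsilon> x \<in> \<Union>E" if "x \<in> \<Union>E" for x using mate_mem[OF E that] .
  have \<tau>H: "?\<tau> x \<in> \<Union>E" if "x \<in> \<Union>E" for x
    using mate_mem[OF J, of x] mate_outside[of x J] that sub by (cases "x \<in> \<Union>J") auto
  have \<epsilon>R: "(x, ?\<epsilon> x) \<in> gen R" if "x \<in> \<Union>E" for x
    using mate_edge(1)[OF E that] by (intro gen_base) (simp add: R_def)
  have \<tau>R: "(x, ?\<tau> x) \<in> gen R" for x
    using mate_edge(1)[OF J, of x] mate_outside[of x J]
    by (cases "x \<in> \<Union>J") (auto intro!: gen_base simp: R_def)
  define f where "f x = ?\<tau> (?\<epsilon> x)" for x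
  have "inj f" unfolding inj_def f_def using \<epsilon>\<epsilon> \<tau>\<tau> by metis
  define a where "a k = (f ^^ k) p" for k
  have a0: "a 0 = p" and aS: "a (Suc k) = ?\<tau> (?\<epsilon> (a k))" for k
    by (simp_all add: a_def f_def)
  have aH: "a k \<in> \<Union>E" for k
    by (induction k) (use p \<epsilon>H \<tau>H in \<open>auto simp: a0 aS simp del: Union_iff\<close>)
  have aR: "(p, a k) \<in> gen R" for k
  proof (induction k)
    case (Suc k)
    then show ?case
      unfolding aS using \<epsilon>R[OF aH] \<tau>R by (blast intro: gen_trans)
  qed (simp add: a0)
  have "finite {y. \<exists>n. y = (f ^^ n) p}"
    by (rule finite_subset[OF _ fin]) (use aH in \<open>auto simp: a_def simp del: Union_iff\<close>)
  then obtain m where m: "m > 0" "a m = p"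
    unfolding a_def using funpow_inj_finite[OF \<open>inj f\<close>] by metis
  define N where "N = (LEAST m. m > 0 \<and> a m = p)"
  have N: "N > 0" "a N = p"
    using LeastI[of "\<lambda>m. m > 0 \<and> a m = p" m] m by (auto simp: N_def)
  have N_min: "a k \<noteq> p" if "0 < k" "k < N" for k
    using not_less_Least[of k "\<lambda>m. m > 0 \<and> a m = p"] that by (auto simp: N_def)
  have inj_a: "i = j" if "a i = a j" "i < N" "j < N" for i j
  proof -
    have "False" if "a i = a j" "i < j" "j < N" for i j
    proof -
      have "(f ^^ i) ((f ^^ (j - i)) p) = (f ^^ i) p"
        using that by (simp add: a_def flip: funpow_add[unfolded o_def, THEN fun_cong])
      then have "a (j - i) = p"
        using inj_fn[OF \<open>inj f\<close>] by (simp add: a_def inj_eq)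
      then show False using N_min[of "j - i"] that by simp
    qed
    then show ?thesis using that by (metis linorder_neqE_nat)
  qed
  \<comment> \<open>The reflections are found alternately: the formula for \<tau> at
    \<open>k\<close> gives the one for \<epsilon> at \<open>k\<close>, and that one gives \<tau> at
    \<open>Suc k\<close>.\<close>
  have \<epsilon>_of_\<tau>: "?\<epsilon> (a k) = a (N - Suc k)" if "?\<tau> (a k) = a (N - k)" "k < N" for k
  proof -
    have "a (N - k) = ?\<tau> (?\<epsilon> (a (N - Suc k)))"
      using aS[of "N - Suc k"] that by (simp add: Suc_diff_Suc)
    then show ?thesis using that \<epsilon>\<epsilon> \<tau>\<tau> by metis
  qed
  have \<tau>a: "?\<tau> (a k) = a (N - k)" if "k \<le> N" for k
    using that
  proof (induction k)
    case 0
    then show ?case using N \<tau>p by (simp add: a0)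
  next
    case (Suc k)
    then show ?case using \<epsilon>_of_\<tau>[of k] by (simp add: aS \<tau>\<tau>)
  qed
  have \<epsilon>a: "?\<epsilon> (a k) = a (N - Suc k)" if "k < N" for k
    using \<epsilon>_of_\<tau> \<tau>a that by simp
  \<comment> \<open>On a cycle of odd length the reflection \<epsilon> would have a fixed point, but
    an edge has two different ends.\<close>
  have "even N"
  proof (rule ccontr)
    assume "odd N"
    then obtain k where "N = 2 * k + 1" by (elim oddE)
    then have "?\<epsilon> (a k) = a k" using \<epsilon>a[of k] by simp
    then show False using mate_edge(2)[OF E aH] by blast
  qed
  then obtain h where h: "N = 2 * h" "h > 0" using N(1) by auto
  \<comment> \<open>Because \<tau> fixes \<open>p\<close>, both reflections preserve this cycle, and
    it is the whole strand. The darts of a closed strand would instead split into two cycles of the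
    product, traversed in opposite directions.\<close>
  define K where "K = a ` {..<N}"
  have K: "x \<in> K" if "(p, x) \<in> gen R" for x
  proof -
    have \<epsilon>K: "?\<epsilon> x \<in> K" if "x \<in> K" for x
      using that N(1) \<epsilon>a by (auto simp: K_def)
    have \<tau>K: "?\<tau> x \<in> K" if x: "x \<in> K" for x
    proof -
      obtain k where "k < N" "x = a k" using x by (auto simp: K_def)
      then show ?thesis using \<tau>a[of k] N \<tau>p x by (cases "k = 0") (auto simp: K_def a0)
    qed
    have "x \<in> K \<longleftrightarrow> y \<in> K" if "(x, y) \<in> R" for x y
    proof -
      have "y = ?\<epsilon> x \<or> y = ?\<tau> x"
        using that pair_iff_mate[OF E] pair_iff_mate[OF J] by (auto simp: R_def)
      then show ?thesis using \<epsilon>K \<tau>K \<epsilon>\<epsilon> \<tau>\<tau> by metis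
    qed
    with that have "p \<in> K \<longleftrightarrow> x \<in> K" by (rule gen_invariant)
    moreover have "p \<in> K" using N(1) a0 by (auto simp: K_def image_iff intro!: bexI[of _ 0])
    ultimately show ?thesis by simp
  qed
  show ?thesis
  proof (rule ex1I[of _ "a h"])
    have "?\<tau> (a h) = a h" using \<tau>a[of h] h by simp
    then have "a h \<notin> \<Union>J" using mate_edge(2)[OF J] by blast
    moreover have "a h \<noteq> p" using N_min[of h] h by simp
    ultimately show "a h \<in> \<Union>E - \<Union>J \<and> a h \<noteq> p \<and> (p, a h) \<in> gen R"
      using aH aR by blast
  next
    fix q assume q: "q \<in> \<Union>E - \<Union>J \<and> q \<noteq> p \<and> (p, q) \<in> gen R"
    then obtain k where k: "k < N" "q = a k" using K by (auto simp: K_def)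
    have "k > 0" using k q a0 by (cases k) auto
    have "?\<tau> q = q" using q by (intro mate_outside) auto
    then have "a (N - k) = a k" using \<tau>a[of k] k by simp
    then have "N - k = k" using inj_a[of "N - k" k] k \<open>k > 0\<close> by simp
    then have "k = h" using h k by linarith
    then show "q = a h" using k by simp
  qed
qed

section \<open>Kauffman states of a tangle\<close>

definition smoothing_joints :: "('d \<times> 'd \<times> 'd \<times> 'd) set \<Rightarrow> 'd \<times> 'd \<times> 'd \<times> 'd \<Rightarrow> 'd set set" where
  "smoothing_joints S = (\<lambda>(a, b, c, d).
     if (a, b, c, d) \<in> S then {{a, b}, {c, d}} else {{a, d}, {b, c}})"

text \<open>All crossings are resolved at once, those in \<open>S\<close> by the B-smoothing and the
  others by the A-smoothing, so that no order of expansion enters.\<close>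

definition smoothing :: "('d \<times> 'd \<times> 'd \<times> 'd) set \<Rightarrow> 'd tangle \<Rightarrow> 'd tangle" where
  "smoothing S T =
     T\<lparr>joints := joints T \<union> \<Union>(smoothing_joints S ` crossings T), crossings := {}\<rparr>"

lemma smoothing_simps [simp]:
  "edges (smoothing S T) = edges T"
  "crossings (smoothing S T) = {}"
  "endpoints (smoothing S T) = endpoints T"
  "darts (smoothing S T) = darts T"
  "edge_rel (smoothing S T) = edge_rel T"
  by (simp_all add: smoothing_def darts_def edge_rel_def)

abbreviation strand_rel :: "'d tangle \<Rightarrow> ('d \<times> 'd) set" where
  "strand_rel T \<equiv> edge_rel T \<union> joint_rel T"

lemma pairing_edges: "tangle_diagram n T \<Longrightarrow> pairing (edges T)"
  and pairing_joints: "tangle_diagram n T \<Longrightarrow> pairing (joints T)"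
  by (simp_all add: tangle_diagram_def pairing_def)

lemma Union_smoothing_joints: "\<Union>(smoothing_joints S x) = corners x"
  by (cases x) (auto simp: smoothing_joints_def corners_def)

lemma tangle_diagram_smoothing:
  assumes T: "tangle_diagram n T"
  shows "tangle_diagram n (smoothing S T)"
proof -
  let ?J = "smoothing_joints S"
  have pair: "card j = 2" if "x \<in> crossings T" "j \<in> ?J x" for x j
    using T that by (cases x) (auto simp: tangle_diagram_def smoothing_joints_def split: if_splits)
  have sub: "j \<subseteq> corners x" if "j \<in> ?J x" for x j
    using that Union_smoothing_joints[of S x] by blast
  have dis_x: "j \<inter> j' = {}" if "x \<in> crossings T" "j \<in> ?J x" "j' \<in> ?J x" "j \<noteq> j'" for x j j'
    using T that by (cases x) (auto simp: tangle_diagram_def smoothing_joints_def split: if_splits)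
  have dis_xy: "corners x \<inter> corners y = {}" if "x \<in> crossings T" "y \<in> crossings T" "x \<noteq> y" for x y
    using T that by (auto simp: tangle_diagram_def disjoint_family_on_def)
  have dis_j: "j \<inter> corners x = {}" if "j \<in> joints T" "x \<in> crossings T" for j x
    using T that by (fastforce simp: tangle_diagram_def)
  have dis: "disjoint (joints (smoothing S T))"
  proof (rule disjointI)
    fix j j' assume j: "j \<in> joints (smoothing S T)" "j' \<in> joints (smoothing S T)" "j \<noteq> j'"
    have old: "j \<inter> j' = {}" if "j \<in> joints T" "j' \<in> joints T"
      using T that j(3) by (auto simp: tangle_diagram_def disjoint_def)
    show "j \<inter> j' = {}"
    proof (cases "j \<in> joints T")
      case True
      show ?thesis
      proof (cases "j' \<in> joints T")
        case False
        then obtain x where "x \<in> crossings T" "j' \<in> ?J x" using j by (auto simp: smoothing_def)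
        then show ?thesis using sub dis_j[OF True] by blast
      qed (use old True in simp)
    next
      case False
      then obtain x where x: "x \<in> crossings T" "j \<in> ?J x" using j by (auto simp: smoothing_def)
      show ?thesis
      proof (cases "j' \<in> joints T")
        case True
        then show ?thesis using sub dis_j x by blast
      next
        case False
        then obtain y where y: "y \<in> crossings T" "j' \<in> ?J y" using j by (auto simp: smoothing_def)
        show ?thesis
        proof (cases "x = y")
          case True
          then show ?thesis using dis_x x y j(3) by blast
        next
          case False
          then show ?thesis using dis_xy[OF x(1) y(1)] sub[OF x(2)] sub[OF y(2)] by blast
        qed
      qed
    qed
  qed
  have un: "\<Union>(joints (smoothing S T)) = \<Union>(joints T) \<union> \<Union>(corners ` crossings T)"
    by (auto simp: smoothing_def simp flip: Union_smoothing_joints[of S])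
  have "\<forall>j\<in>joints (smoothing S T). card j = 2"
    using T pair by (auto simp: tangle_diagram_def smoothing_def)
  then show ?thesis
    using T dis un unfolding tangle_diagram_def by (auto simp: disjoint_family_on_def)
qed

text \<open>Without crossings, the endpoints are the darts that lie on an edge but in no joint. They
  are the fixed points of the joint involution, and the orbit argument pairs them.\<close>

lemma strand_ends:
  assumes T: "tangle_diagram n T" "crossings T = {}" and p: "p \<in> set (endpoints T)"
  shows "\<exists>!q. q \<in> set (endpoints T) \<and> q \<noteq> p \<and> (p, q) \<in> gen (strand_rel T)"
proof -
  have "\<Union>(edges T) - \<Union>(joints T) = set (endpoints T)" "\<Union>(joints T) \<subseteq> \<Union>(edges T)" "finite (\<Union>(edges T))"
    using T by (auto simp: tangle_diagram_def darts_def)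
  then show ?thesis
    using involution_pair_orbit[OF pairing_edges[OF T(1)] pairing_joints[OF T(1)], of p] p
    by (simp add: edge_rel_def joint_rel_def)
qed

section \<open>The successor relation as a permutation of the darts\<close>

definition perm_graph :: "'a set \<Rightarrow> ('a \<times> 'a) set \<Rightarrow> bool" where
  "perm_graph X R \<longleftrightarrow> R \<subseteq> X \<times> X \<and> (\<forall>x\<in>X. \<exists>!y. (x, y) \<in> R) \<and> (\<forall>y\<in>X. \<exists>!x. (x, y) \<in> R)"

lemma perm_graphI:
  assumes "R \<subseteq> X \<times> X" "\<And>x. x \<in> X \<Longrightarrow> (\<exists>!y. (x, y) \<in> R) \<and> (\<exists>!y. (y, x) \<in> R)"
  shows "perm_graph X R"
  using assms by (simp add: perm_graph_def)

text \<open>Permutations are handled as graphs because \<open>next_rel\<close> is a union of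
  relations with disjoint supports (joints, crossings, boundary), each of which permutes its own
  support.\<close>

lemma perm_graph_Un:
  assumes "perm_graph X R" "perm_graph Y S" "X \<inter> Y = {}"
  shows "perm_graph (X \<union> Y) (R \<union> S)"
proof -
  have R: "R \<subseteq> X \<times> X" and S: "S \<subseteq> Y \<times> Y" using assms by (auto simp: perm_graph_def)
  have *: "(\<exists>!y. (x, y) \<in> R \<union> S) \<and> (\<exists>!y. (y, x) \<in> R \<union> S)" if "x \<in> X" for x
  proof -
    have "(x, y) \<notin> S" "(y, x) \<notin> S" for y using that S assms(3) by auto
    then show ?thesis using assms(1) that by (simp add: perm_graph_def)
  qed
  have **: "(\<exists>!y. (x, y) \<in> R \<union> S) \<and> (\<exists>!y. (y, x) \<in> R \<union> S)" if "x \<in> Y" for x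
  proof -
    have "(x, y) \<notin> R" "(y, x) \<notin> R" for y using that R assms(3) by auto
    then show ?thesis using assms(2) that by (simp add: perm_graph_def)
  qed
  show ?thesis
  proof (rule perm_graphI)
    show "R \<union> S \<subseteq> (X \<union> Y) \<times> (X \<union> Y)" using R S by blast
  qed (elim UnE; fact * **)
qed

lemma perm_graph_UN:
  assumes "disjoint_family_on X I" "\<And>i. i \<in> I \<Longrightarrow> perm_graph (X i) (R i)"
  shows "perm_graph (\<Union>i\<in>I. X i) (\<Union>i\<in>I. R i)"
proof -
  have R: "R i \<subseteq> X i \<times> X i" if "i \<in> I" for i using assms(2)[OF that] by (simp add: perm_graph_def)
  have *: "(\<exists>!y. (x, y) \<in> (\<Union>i\<in>I. R i)) \<and> (\<exists>!y. (y, x) \<in> (\<Union>i\<in>I. R i))" if x: "x \<in> X i" and i: "i \<in> I" for x i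
  proof -
    have *: "j = i" if "j \<in> I" "(x, y) \<in> R j \<or> (y, x) \<in> R j" for y j
    proof (rule ccontr)
      assume "j \<noteq> i"
      then have "X i \<inter> X j = {}" using assms(1) i that(1) by (auto simp: disjoint_family_on_def)
      moreover have "x \<in> X j" using R[OF that(1)] that(2) by blast
      ultimately show False using x by blast
    qed
    have "(x, y) \<in> (\<Union>i\<in>I. R i) \<longleftrightarrow> (x, y) \<in> R i" "(y, x) \<in> (\<Union>i\<in>I. R i) \<longleftrightarrow> (y, x) \<in> R i" for y
      using i * by blast+
    then show ?thesis
      using assms(2)[OF i] x by (simp add: perm_graph_def)
  qed
  show ?thesis
  proof (rule perm_graphI)
    show "(\<Union>i\<in>I. R i) \<subseteq> (\<Union>i\<in>I. X i) \<times> (\<Union>i\<in>I. X i)"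
      using R by blast
    fix x assume "x \<in> (\<Union>i\<in>I. X i)"
    then obtain i where "i \<in> I" "x \<in> X i" by blast
    then show "(\<exists>!y. (x, y) \<in> (\<Union>i\<in>I. R i)) \<and> (\<exists>!y. (y, x) \<in> (\<Union>i\<in>I. R i))" by (intro *)
  qed
qed

lemma perm_graph_zip:
  assumes "distinct xs" "distinct ys" "set xs = set ys"
  shows "perm_graph (set xs) (set (zip xs ys))"
proof -
  have len: "length xs = length ys" using assms by (metis distinct_card)
  then have mem: "(x, y) \<in> set (zip xs ys) \<longleftrightarrow> (\<exists>i<length xs. x = xs ! i \<and> y = ys ! i)" for x y
    by (auto simp: in_set_zip)
  show ?thesis
  proof (rule perm_graphI)
    show "set (zip xs ys) \<subseteq> set xs \<times> set xs"
      using assms(3) set_zip_leftD set_zip_rightD by fast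
    fix x assume "x \<in> set xs"
    then obtain i j where ij: "i < length xs" "x = xs ! i" "j < length xs" "x = ys ! j"
      using assms(3) len by (metis in_set_conv_nth)
    have "\<exists>!y. (xs ! i, y) \<in> set (zip xs ys)"
      using ij assms(1) by (auto simp: mem nth_eq_iff_index_eq)
    moreover have "\<exists>!y. (y, ys ! j) \<in> set (zip xs ys)"
      using ij assms(2) len by (auto simp: mem nth_eq_iff_index_eq intro!: ex1I[of _ "xs ! j"])
    ultimately show "(\<exists>!y. (x, y) \<in> set (zip xs ys)) \<and> (\<exists>!y. (y, x) \<in> set (zip xs ys))"
      using ij by simp
  qed
qed

lemma perm_graph_function:
  assumes "perm_graph X R"
  obtains \<sigma> where "bij_betw \<sigma> X X" "R = {(x, \<sigma> x) |x. x \<in> X}"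
proof -
  define \<sigma> where "\<sigma> x = (THE y. (x, y) \<in> R)" for x
  have \<sigma>: "(x, y) \<in> R \<longleftrightarrow> x \<in> X \<and> y = \<sigma> x" for x y
  proof (cases "x \<in> X")
    case True
    then have "\<exists>!y. (x, y) \<in> R" using assms by (simp add: perm_graph_def)
    then show ?thesis unfolding \<sigma>_def using True by (metis (mono_tags, lifting) the_equality)
  next
    case False
    then show ?thesis using assms by (auto simp: perm_graph_def)
  qed
  have "inj_on \<sigma> X"
    using assms \<sigma> unfolding perm_graph_def inj_on_def by blast
  moreover have "\<sigma> ` X = X"
    using assms \<sigma> unfolding perm_graph_def by blast
  ultimately show thesis
    by (intro that[of \<sigma>]) (auto simp: bij_betw_def \<sigma>)
qed

lemma perm_graph_next:
  assumes T: "tangle_diagram n T" and bs: "distinct bs" "set bs = set (endpoints T)"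
  shows "perm_graph (darts T) (next_rel bs T)"
proof -
  let ?C = "\<lambda>(a, b, c, d). {(a, b), (b, c), (c, d), (d, a)}"
  have 1: "perm_graph (\<Union>(joints T)) (joint_rel T)"
  proof -
    let ?\<tau> = "mate (joints T)"
    have J: "(x, y) \<in> joint_rel T \<longleftrightarrow> x \<in> \<Union>(joints T) \<and> y = ?\<tau> x" for x y
      by (simp add: joint_rel_def pair_iff_mate[OF pairing_joints[OF T]])
    have \<tau>: "?\<tau> (?\<tau> x) = x" "x \<in> \<Union>(joints T) \<Longrightarrow> ?\<tau> x \<in> \<Union>(joints T)" for x
      using mate_mate mate_mem pairing_joints[OF T] by metis+
    show ?thesis
    proof (rule perm_graphI)
      show "joint_rel T \<subseteq> \<Union>(joints T) \<times> \<Union>(joints T)"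
        using J \<tau>(2) by (metis (no_types, lifting) mem_Sigma_iff subrelI)
      show "(\<exists>!y. (x, y) \<in> joint_rel T) \<and> (\<exists>!y. (y, x) \<in> joint_rel T)" if "x \<in> \<Union>(joints T)" for x
      proof
        show "\<exists>!y. (x, y) \<in> joint_rel T" using that by (simp only: J) simp
        show "\<exists>!y. (y, x) \<in> joint_rel T"
          using that \<tau> by (intro ex1I[of _ "?\<tau> x"]) (metis J)+
      qed
    qed
  qed
  have 2: "perm_graph (\<Union>(corners ` crossings T)) (\<Union>(?C ` crossings T))"
  proof (rule perm_graph_UN)
    show "disjoint_family_on corners (crossings T)" using T by (simp add: tangle_diagram_def)
    show "perm_graph (corners x) (?C x)" if "x \<in> crossings T" for x
    proof (cases x)
      case (fields a b c d)
      then have "distinct [a, b, c, d]" using T that by (auto simp: tangle_diagram_def)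
      then show ?thesis by (auto simp: fields perm_graph_def corners_def)
    qed
  qed
  have 3: "perm_graph (set bs) (set (zip bs (rotate1 bs)))"
    using bs(1) by (intro perm_graph_zip) simp_all
  have disj: "\<Union>(joints T) \<inter> \<Union>(corners ` crossings T) = {}"
    "(\<Union>(joints T) \<union> \<Union>(corners ` crossings T)) \<inter> set bs = {}"
    and darts: "darts T = \<Union>(joints T) \<union> \<Union>(corners ` crossings T) \<union> set bs"
    using T bs(2) by (auto simp: tangle_diagram_def)
  show ?thesis
    unfolding next_rel_def darts by (rule perm_graph_Un[OF perm_graph_Un[OF 1 2 disj(1)] 3 disj(2)])
qed

text \<open>Around a crossing \<open>(a, b, c, d)\<close>, the B-smoothing joins the neighbours
  \<open>a\<close>, \<open>b\<close> and \<open>c\<close>, \<open>d\<close>, the A-smoothing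
  \<open>d\<close>, \<open>a\<close> and \<open>b\<close>, \<open>c\<close>; opposite darts are
  never joined. This is what lets every state be studied inside the unsmoothed planar map.\<close>

lemma smoothing_joint_next:
  assumes "{x, y} \<in> joints (smoothing S T)"
  shows "(x, y) \<in> next_rel bs T \<or> (y, x) \<in> next_rel bs T"
proof (cases "{x, y} \<in> joints T")
  case True
  then show ?thesis by (simp add: next_rel_def joint_rel_def)
next
  case False
  then obtain a b c d where abcd: "(a, b, c, d) \<in> crossings T" "{x, y} \<in> smoothing_joints S (a, b, c, d)"
    using assms by (auto simp: smoothing_def)
  have next_C: "{(a, b), (b, c), (c, d), (d, a)} \<subseteq> next_rel bs T"
    unfolding next_rel_def using abcd(1)
    by (intro subsetI UnI1 UnI2 UN_I[of "(a, b, c, d)"]) auto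
  show ?thesis
  proof (cases "(a, b, c, d) \<in> S")
    case True
    then have "{x, y} = {a, b} \<or> {x, y} = {c, d}" using abcd(2) by (simp add: smoothing_joints_def)
    then show ?thesis using next_C by (auto simp: doubleton_eq_iff)
  next
    case False
    then have "{x, y} = {d, a} \<or> {x, y} = {b, c}"
      using abcd(2) by (simp add: smoothing_joints_def insert_commute)
    then show ?thesis using next_C by (auto simp: doubleton_eq_iff)
  qed
qed

text \<open>The strand through one pair of endpoints is the boundary of a set \<open>C\<close> of regions, and the
  other strand cannot leave \<open>C\<close>.\<close>

lemma strands_noncrossing:
  assumes T: "tangle_diagram n T" and planar: "planar bs T"
    and bs: "distinct bs" "set bs = set (endpoints T)"
    and ijkl: "i < j" "j < k" "k < l" "l < length bs"
    and ik: "(bs ! i, bs ! k) \<in> gen (strand_rel (smoothing S T))"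
    and jl: "(bs ! j, bs ! l) \<in> gen (strand_rel (smoothing S T))"
  shows "(bs ! i, bs ! j) \<in> gen (strand_rel (smoothing S T))"
proof (rule ccontr)
  let ?U = "smoothing S T" and ?H = "darts T"
  let ?G = "gen (strand_rel ?U)"
  assume not: "(bs ! i, bs ! j) \<notin> ?G"
  have U: "tangle_diagram n ?U" using T by (rule tangle_diagram_smoothing)
  have E: "pairing (edges T)" and J: "pairing (joints ?U)"
    using T U by (auto intro: pairing_edges pairing_joints)
  have fin: "finite ?H" and H: "\<Union>(edges T) = ?H" using T by (auto simp: tangle_diagram_def darts_def)
  have HJ: "?H = set bs \<union> \<Union>(joints ?U)" "set bs \<inter> \<Union>(joints ?U) = {}"
    using U bs by (auto simp: tangle_diagram_def)
  obtain \<sigma> where \<sigma>: "bij_betw \<sigma> ?H ?H" "next_rel bs T = {(x, \<sigma> x) |x. x \<in> ?H}"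
    using perm_graph_function[OF perm_graph_next[OF T bs]] by blast
  have next_iff: "(x, y) \<in> next_rel bs T \<longleftrightarrow> x \<in> ?H \<and> y = \<sigma> x" for x y
    using \<sigma>(2) by auto
  \<comment> \<open>The strand from \<open>bs ! i\<close> to \<open>bs ! k\<close>. The collapsed
    boundary vertex closes it up to a cycle.\<close>
  define K where "K = {x \<in> ?H. (bs ! i, x) \<in> ?G}"
  have GH: "x \<in> ?H \<and> y \<in> ?H" if "(x, y) \<in> strand_rel ?U" for x y
    using that HJ(1) H by (auto simp: edge_rel_def joint_rel_def)
  have strandK: "x \<in> K \<longleftrightarrow> y \<in> K" if "(x, y) \<in> strand_rel ?U" for x y
    using GH[OF that] gen_base[OF that] gen_sym[OF gen_base[OF that]]
    unfolding K_def by (blast intro: gen_trans)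
  have mateE: "(x, mate (edges T) x) \<in> strand_rel ?U" if "x \<in> ?H" for x
    using mate_edge(1)[OF E, of x] that H by (simp add: edge_rel_def)
  have mateJ: "(x, mate (joints ?U) x) \<in> strand_rel ?U" if "x \<in> \<Union>(joints ?U)" for x
    using mate_edge(1)[OF J that] by (simp add: joint_rel_def)
  have KH: "K \<subseteq> ?H" by (auto simp: K_def)
  have finK: "finite K" using KH fin by (rule finite_subset)
  have ends: "bs ! t \<in> K \<longleftrightarrow> t = i \<or> t = k" if t: "t < length bs" for t
  proof -
    have len: "i < length bs" "k < length bs" using ijkl by auto
    then have mem: "bs ! i \<in> set (endpoints ?U)" "bs ! k \<in> set (endpoints ?U)" "bs ! t \<in> set (endpoints ?U)"
      using t bs(2) nth_mem by (metis smoothing_simps(3))+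
    have "bs ! k \<noteq> bs ! i" using bs(1) len ijkl by (simp add: nth_eq_iff_index_eq)
    then have "(bs ! i, bs ! t) \<in> ?G \<and> bs ! t \<noteq> bs ! i \<longleftrightarrow> bs ! t = bs ! k"
      using strand_ends[OF U _ mem(1)] mem ik by (metis smoothing_simps(2))
    moreover have "bs ! t \<in> ?H" using t HJ(1) by simp
    ultimately have "bs ! t \<in> K \<longleftrightarrow> bs ! t = bs ! i \<or> bs ! t = bs ! k"
      using ik by (auto simp: K_def)
    then show ?thesis using bs(1) t len by (simp add: nth_eq_iff_index_eq)
  qed
  have next_bs: "(bs ! t, bs ! (Suc t mod length bs)) \<in> next_rel bs T" if "t < length bs" for t
  proof -
    have "(bs ! t, rotate1 bs ! t) \<in> set (zip bs (rotate1 bs))"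
      using that by (auto simp: in_set_zip)
    then show ?thesis using that by (simp add: nth_rotate1 next_rel_def)
  qed
  \<comment> \<open>Off the boundary, joints group the darts of such a set into pairs, so only
    endpoints can affect the parity.\<close>
  have even_off: "even (card (X - set bs))" if X: "X \<subseteq> ?H" "\<And>x. x \<in> X - set bs \<Longrightarrow> mate (joints ?U) x \<in> X" for X
  proof (rule even_card_mate[OF J])
    show "finite (X - set bs)" using X(1) fin by (auto intro: finite_subset)
    show "X - set bs \<subseteq> \<Union>(joints ?U)" using X(1) HJ(1) by blast
    then show "mate (joints ?U) x \<in> X - set bs" if "x \<in> X - set bs" for x
      using X(2)[OF that] mate_mem[OF J, of x] HJ(2) that by blast
  qed
  have joint: "x \<in> \<Union>(joints ?U)" if "x \<in> ?H - set bs" for x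
    using that HJ(1) by blast
  have KmateJ: "mate (joints ?U) x \<in> K" if "x \<in> K - set bs" for x
    using strandK mateJ joint that KH by blast
  have even_ends: "even (card (K \<inter> set bs))"
  proof -
    have "even (card K)"
    proof (rule even_card_mate[OF E finK])
      show "K \<subseteq> \<Union>(edges T)" using KH H by simp
      show "mate (edges T) x \<in> K" if "x \<in> K" for x
        using strandK mateE KH that by blast
    qed
    moreover have "even (card (K - set bs))" using KH KmateJ by (rule even_off)
    moreover have "card K = card (K - set bs) + card (K \<inter> set bs)"
      using finK by (metis card_Diff_subset_Int card_Int_Diff add.commute finite_Int)
    ultimately show ?thesis by simp
  qed
  have cycle: "even (card (Y \<inter> K))" if Y: "Y \<in> saturated ?H (next_rel bs T)" for Y
  proof -
    have sat: "x \<in> Y \<longleftrightarrow> y \<in> Y" if "(x, y) \<in> next_rel bs T" for x y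
      using Y that by (auto simp: saturated_def)
    have "mate (joints ?U) x \<in> Y" if "x \<in> Y" "x \<in> \<Union>(joints ?U)" for x
      using smoothing_joint_next[OF mate_edge(1)[OF J that(2)], of bs] sat that(1) by blast
    then have off: "even (card (Y \<inter> K - set bs))"
      using KmateJ KH joint by (intro even_off) auto
    \<comment> \<open>All endpoints belong to the one boundary vertex, so \<open>Y\<close> contains
      all of them or none.\<close>
    have "bs ! t \<in> Y \<longleftrightarrow> bs ! 0 \<in> Y" if "t < length bs" for t
      using that
    proof (induction t)
      case (Suc t)
      then show ?case using sat[OF next_bs[of t]] by simp
    qed simp
    then have "set bs \<subseteq> Y \<or> Y \<inter> set bs = {}"
      by (fastforce simp: in_set_conv_nth)
    then have "even (card (Y \<inter> K \<inter> set bs))"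
    proof
      assume "set bs \<subseteq> Y"
      then have "Y \<inter> K \<inter> set bs = K \<inter> set bs" by blast
      then show ?thesis using even_ends by simp
    next
      assume "Y \<inter> set bs = {}"
      then have "Y \<inter> K \<inter> set bs = {}" by blast
      then show ?thesis by simp
    qed
    moreover have "card (Y \<inter> K) = card (Y \<inter> K - set bs) + card (Y \<inter> K \<inter> set bs)"
      using finK by (metis card_Diff_subset_Int card_Int_Diff add.commute finite_Int)
    ultimately show ?thesis using off by simp
  qed
  have euler: "num_classes ?H (next_rel bs T) + num_classes ?H (edge_rel T O next_rel bs T) =
      card (edges T) + 2 * num_classes ?H (edge_rel T \<union> next_rel bs T)"
    using planar unfolding planar_def by linarith
  obtain C where C: "\<And>x. x \<in> ?H \<Longrightarrow> x \<in> C \<longleftrightarrow> \<sigma> (mate (edges T) x) \<in> C"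
    "\<And>x. x \<in> ?H \<Longrightarrow> x \<in> K \<longleftrightarrow> (x \<in> C) \<noteq> (\<sigma> x \<in> C)"
  proof (rule planar_cycle_bounds[of "edges T" \<sigma> K])
    show "mate (edges T) x \<in> K" if "x \<in> K" for x
      using strandK mateE that KH by blast
  qed (use E fin H \<sigma> KH cycle euler in \<open>auto simp: edge_rel_def\<close>)
  have next_C: "x \<in> C \<longleftrightarrow> y \<in> C" if "(x, y) \<in> next_rel bs T" "x \<notin> K" for x y
    using that C(2)[of x] by (auto simp: next_iff)
  \<comment> \<open>Along the strand \<open>K\<close> itself membership in \<open>C\<close> changes,
    so the invariant is the union of both: \<open>K\<close> consists of whole strands, and outside
    \<open>K\<close> neither an edge nor a joint leads out of \<open>C\<close>.\<close>
  have "(x \<in> K \<or> x \<in> C) = (y \<in> K \<or> y \<in> C)" if xy: "(x, y) \<in> strand_rel ?U" for x y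
  proof (cases "x \<in> K")
    case True
    then show ?thesis using strandK[OF xy] by simp
  next
    case False
    then have nK: "x \<notin> K" "y \<notin> K" and xyH: "x \<in> ?H" "y \<in> ?H"
      using strandK[OF xy] GH[OF xy] by auto
    have "x \<in> C \<longleftrightarrow> y \<in> C"
    proof (cases "{x, y} \<in> edges T")
      case True
      then have "mate (edges T) x = y" by (rule mate_eqI[OF E])
      then show ?thesis using C(1)[OF xyH(1)] C(2)[OF xyH(2)] nK by simp
    next
      case False
      then have "{x, y} \<in> joints ?U" using xy by (simp add: edge_rel_def joint_rel_def)
      then show ?thesis using smoothing_joint_next[of x y S T bs] next_C nK by blast
    qed
    then show ?thesis using nK by simp
  qed
  with jl have "(bs ! j \<in> K \<or> bs ! j \<in> C) = (bs ! l \<in> K \<or> bs ! l \<in> C)"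
    by (rule gen_invariant)
  then have jlC: "bs ! j \<in> C \<longleftrightarrow> bs ! l \<in> C"
    using ends[of j] ends[of l] ijkl by simp
  have \<sigma>_bs: "\<sigma> (bs ! t) = bs ! Suc t" if "Suc t < length bs" for t
    using next_bs[of t] that by (simp add: next_iff)
  have const: "bs ! s \<in> C \<longleftrightarrow> bs ! t \<in> C"
    if "s \<le> t" "t < length bs" "\<And>u. s \<le> u \<Longrightarrow> u < t \<Longrightarrow> u \<noteq> i \<and> u \<noteq> k" for s t
    using that
  proof (induction t rule: dec_induct)
    case (step t)
    have "bs ! t \<in> ?H" using step.prems HJ(1) by simp
    then have "bs ! t \<in> C \<longleftrightarrow> bs ! Suc t \<in> C"
      using C(2)[of "bs ! t"] ends[of t] \<sigma>_bs[of t] step by auto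
    then show ?case using step by simp
  qed simp
  \<comment> \<open>Around the boundary the side changes exactly between \<open>t\<close> and
    \<open>Suc t\<close> for \<open>t\<close> equal to \<open>i\<close> or \<open>k\<close>, that
    is, just after an end of the strand. On the way from \<open>j\<close> to \<open>l\<close> only
    the change after \<open>k\<close> is met, so \<open>j\<close> and \<open>l\<close> lie on
    different sides.\<close>
  have "bs ! j \<in> C \<longleftrightarrow> bs ! k \<in> C" "bs ! Suc k \<in> C \<longleftrightarrow> bs ! l \<in> C"
    using ijkl by (intro const; force)+
  moreover have "bs ! k \<in> ?H" using ijkl HJ(1) by simp
  then have "(bs ! k \<in> C) \<noteq> (bs ! Suc k \<in> C)"
    using C(2)[of "bs ! k"] ends[of k] \<sigma>_bs[of k] ijkl by simp
  ultimately show False using jlC by blast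
qed

section \<open>State sums of glued tangles\<close>

lemma bracket_crossingless: "crossings D = {} \<Longrightarrow> bracket D = loop_value ^ (num_circles D - 1)"
  by (subst bracket.simps) simp

lemma smoothing_crossingless: "crossings D = {} \<Longrightarrow> smoothing S D = D"
  by (cases D) (simp add: smoothing_def)

text \<open>Resolving \<open>x\<close> first and the rest according to \<open>S\<close> is a state
  of the original diagram. This matches the recursion of the bracket with the enumeration of
  states.\<close>

lemma smoothing_smooth:
  assumes "x \<in> crossings D" "x \<notin> S"
  shows "smoothing S (smooth_A x D) = smoothing S D"
    and "smoothing S (smooth_B x D) = smoothing (insert x S) D"
proof -
  obtain a b c d where x: "x = (a, b, c, d)" by (cases x)
  have C: "smoothing_joints S' ` crossings D =
      insert (smoothing_joints S' x) (smoothing_joints S' ` (crossings D - {x}))" for S'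
    using assms(1) by (metis image_insert insert_Diff)
  have "\<Union>(smoothing_joints S ` crossings D) =
      {{a, d}, {b, c}} \<union> \<Union>(smoothing_joints S ` (crossings D - {x}))"
    unfolding C by (subst smoothing_joints_def) (use assms(2) in \<open>simp add: x\<close>)
  then show "smoothing S (smooth_A x D) = smoothing S D"
    by (simp add: smoothing_def smooth_A_def x Un_assoc)
  have "smoothing_joints (insert x S) ` (crossings D - {x}) = smoothing_joints S ` (crossings D - {x})"
    by (intro image_cong refl) (auto simp: smoothing_joints_def)
  then have "\<Union>(smoothing_joints (insert x S) ` crossings D) =
      {{a, b}, {c, d}} \<union> \<Union>(smoothing_joints S ` (crossings D - {x}))"
    unfolding C by (subst smoothing_joints_def) (simp add: x)
  then show "smoothing S (smooth_B x D) = smoothing (insert x S) D"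
    by (simp add: smoothing_def smooth_B_def x Un_assoc)
qed

text \<open>Kauffman's state sum. With c crossings and b of them B-smoothed the exponent is (c - b)
  - b; the skein relation at \<open>x\<close> splits the states by whether \<open>S\<close> contains
  \<open>x\<close>.\<close>

lemma bracket_state_sum:
  assumes "finite (crossings D)"
  shows "bracket D = (\<Sum>S\<in>Pow (crossings D).
    A_pow (int (card (crossings D)) - 2 * int (card S)) * loop_value ^ (num_circles (smoothing S D) - 1))"
  using assms
proof (induction "card (crossings D)" arbitrary: D)
  case 0
  then show ?case by (simp add: bracket_crossingless smoothing_crossingless A_pow_0)
next
  case (Suc n)
  then have "crossings D \<noteq> {}" by (metis card.empty nat.distinct(1))
  then obtain x where x: "x \<in> crossings D" by blast
  let ?C = "crossings D - {x}"
  let ?g = "\<lambda>S. loop_value ^ (num_circles (smoothing S D) - 1)"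
  have C: "crossings D = insert x ?C" using x by blast
  have card: "card ?C = n" "card (crossings D) = Suc n" using Suc x by simp_all
  have fin: "finite (Pow ?C)" using Suc.prems by simp
  have A: "A_pow 1 * bracket (smooth_A x D) =
      (\<Sum>S\<in>Pow ?C. A_pow (int (Suc n) - 2 * int (card S)) * ?g S)"
  proof -
    have "bracket (smooth_A x D) =
        (\<Sum>S\<in>Pow ?C. A_pow (int n - 2 * int (card S)) * loop_value ^ (num_circles (smoothing S (smooth_A x D)) - 1))"
      using Suc.hyps(1)[of "smooth_A x D"] card Suc.prems by simp
    also have "A_pow 1 * \<dots> = (\<Sum>S\<in>Pow ?C. A_pow (int (Suc n) - 2 * int (card S)) * ?g S)"
      unfolding sum_distrib_left
    proof (intro sum.cong refl)
      fix S assume "S \<in> Pow ?C"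
      then have "smoothing S (smooth_A x D) = smoothing S D"
        using x by (intro smoothing_smooth) auto
      moreover have "A_pow (int (Suc n) - 2 * int (card S)) = A_pow 1 * A_pow (int n - 2 * int (card S))"
        by (simp flip: A_pow_add add: algebra_simps)
      ultimately show "A_pow 1 * (A_pow (int n - 2 * int (card S)) * loop_value ^ (num_circles (smoothing S (smooth_A x D)) - 1))
          = A_pow (int (Suc n) - 2 * int (card S)) * ?g S"
        by (simp add: mult.assoc)
    qed
    finally show ?thesis .
  qed
  have B: "A_pow (-1) * bracket (smooth_B x D) =
      (\<Sum>S\<in>insert x ` Pow ?C. A_pow (int (Suc n) - 2 * int (card S)) * ?g S)"
  proof -
    have inj: "inj_on (insert x) (Pow ?C)"
      by (rule inj_onI) (metis Diff_insert_absorb PowD insertCI subset_Diff_insert)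
    have "bracket (smooth_B x D) =
        (\<Sum>S\<in>Pow ?C. A_pow (int n - 2 * int (card S)) * loop_value ^ (num_circles (smoothing S (smooth_B x D)) - 1))"
      using Suc.hyps(1)[of "smooth_B x D"] card Suc.prems by simp
    also have "A_pow (-1) * \<dots> = (\<Sum>S\<in>Pow ?C. A_pow (int (Suc n) - 2 * int (card (insert x S))) * ?g (insert x S))"
      unfolding sum_distrib_left
    proof (intro sum.cong refl)
      fix S assume S: "S \<in> Pow ?C"
      then have "smoothing S (smooth_B x D) = smoothing (insert x S) D"
        using x by (intro smoothing_smooth) auto
      moreover have "card (insert x S) = Suc (card S)"
        using S Suc.prems by (subst card_insert_disjoint) (auto intro: finite_subset)
      moreover from this have "A_pow (int (Suc n) - 2 * int (card (insert x S))) = A_pow (-1) * A_pow (int n - 2 * int (card S))"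
        by (simp flip: A_pow_add add: algebra_simps)
      ultimately show "A_pow (-1) * (A_pow (int n - 2 * int (card S)) * loop_value ^ (num_circles (smoothing S (smooth_B x D)) - 1))
          = A_pow (int (Suc n) - 2 * int (card (insert x S))) * ?g (insert x S)"
        by (simp add: mult.assoc)
    qed
    finally show ?thesis by (simp only: sum.reindex[OF inj] o_def)
  qed
  have "Pow (crossings D) = Pow ?C \<union> insert x ` Pow ?C"
    by (subst C) (rule Pow_insert)
  moreover have "Pow ?C \<inter> insert x ` Pow ?C = {}" by auto
  ultimately have "(\<Sum>S\<in>Pow (crossings D). A_pow (int (Suc n) - 2 * int (card S)) * ?g S) =
      A_pow 1 * bracket (smooth_A x D) + A_pow (-1) * bracket (smooth_B x D)"
    using fin unfolding A B by (simp only: sum.union_disjoint finite_imageI)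
  then show ?case
    using bracket_skein[OF Suc.prems x] card by simp
qed

section \<open>States and strands of a glued diagram\<close>

lemma inj_map_crossing: "inj f \<Longrightarrow> inj (map_crossing f)"
  by (auto simp: inj_def map_crossing_def)

lemma map_crossing_eq_iff [simp]:
  "map_crossing Inl x = map_crossing Inl y \<longleftrightarrow> x = y"
  "map_crossing Inr x' = map_crossing Inr y' \<longleftrightarrow> x' = y'"
  "map_crossing Inl x \<noteq> map_crossing Inr x'"
  "map_crossing Inr x' \<noteq> map_crossing Inl x"
  by (auto simp: map_crossing_def split: prod.splits)

lemma card_glue_states:
  assumes "finite S" "finite S'"
  shows "card (map_crossing Inl ` S \<union> map_crossing Inr ` S') = card S + card S'"
  using assms by (subst card_Un_disjoint)
    (auto simp: card_image[OF inj_on_subset[OF inj_map_crossing subset_UNIV]])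

lemma smoothing_glue:
  "smoothing (map_crossing Inl ` S \<union> map_crossing Inr ` S') (glue T T') = glue (smoothing S T) (smoothing S' T')"
proof -
  let ?S = "map_crossing Inl ` S \<union> map_crossing Inr ` S'"
  have "smoothing_joints ?S (map_crossing Inl x) = image Inl ` smoothing_joints S x" for x
  proof -
    have "map_crossing Inl x \<in> ?S \<longleftrightarrow> x \<in> S" by auto
    then show ?thesis
      by (cases x) (simp add: smoothing_joints_def map_crossing_def)
  qed
  moreover have "smoothing_joints ?S (map_crossing Inr x) = image Inr ` smoothing_joints S' x" for x
  proof -
    have "map_crossing Inr x \<in> ?S \<longleftrightarrow> x \<in> S'" by auto
    then show ?thesis
      by (cases x) (simp add: smoothing_joints_def map_crossing_def)
  qed
  ultimately show ?thesis
    by (simp add: smoothing_def glue_def image_Un image_UN image_image Un_ac)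
qed

text \<open>Connectivity is recorded by positions, counted from 0, rather than by darts, so that
  tangles with different dart types can be compared. The diagonal is included.\<close>

definition ends :: "'d tangle \<Rightarrow> (nat \<times> nat) set" where
  "ends T = {(i, j). i < length (endpoints T) \<and> j < length (endpoints T) \<and>
     (endpoints T ! i, endpoints T ! j) \<in> gen (strand_rel T)}"

definition loops :: "'d tangle \<Rightarrow> nat" where
  "loops T = card {c \<in> classes (darts T) (strand_rel T). c \<inter> set (endpoints T) = {}}"

lemma pair_mem_image_iff:
  assumes "inj f"
  shows "{x, y} \<in> image f ` P \<longleftrightarrow> (\<exists>a b. x = f a \<and> y = f b \<and> {a, b} \<in> P)"
proof
  assume "{x, y} \<in> image f ` P"
  then obtain e where e: "e \<in> P" "f ` e = {x, y}" by (metis imageE)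
  have "x \<in> f ` e" "y \<in> f ` e" by (simp_all add: e(2))
  then obtain a b where ab: "x = f a" "y = f b" by blast
  then have "f ` e = f ` {a, b}" using e(2) by simp
  then have "e = {a, b}" using assms by (simp only: inj_image_eq_iff)
  then show "\<exists>a b. x = f a \<and> y = f b \<and> {a, b} \<in> P" using e(1) ab by blast
next
  assume "\<exists>a b. x = f a \<and> y = f b \<and> {a, b} \<in> P"
  then obtain a b where "{x, y} = f ` {a, b}" "{a, b} \<in> P" by auto
  then show "{x, y} \<in> image f ` P" by (metis imageI)
qed

lemma strand_rel_glue:
  assumes "length (endpoints T) = m" "length (endpoints T') = m"
  shows "(z, z') \<in> strand_rel (glue T T') \<longleftrightarrow>
    (\<exists>a b. z = Inl a \<and> z' = Inl b \<and> (a, b) \<in> strand_rel T) \<or>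
    (\<exists>a b. z = Inr a \<and> z' = Inr b \<and> (a, b) \<in> strand_rel T') \<or>
    (\<exists>i<m. z = Inl (endpoints T ! i) \<and> z' = Inr (endpoints T' ! i)) \<or>
    (\<exists>i<m. z' = Inl (endpoints T ! i) \<and> z = Inr (endpoints T' ! i))"
proof -
  have "(\<exists>p q. {z, z'} = {Inl p, Inr q} \<and> (p, q) \<in> set (zip (endpoints T) (endpoints T'))) \<longleftrightarrow>
      (\<exists>i<m. z = Inl (endpoints T ! i) \<and> z' = Inr (endpoints T' ! i)) \<or>
      (\<exists>i<m. z' = Inl (endpoints T ! i) \<and> z = Inr (endpoints T' ! i))"
    using assms by (auto simp: set_zip doubleton_eq_iff)
  moreover have "{z, z'} \<in> joints (glue T T') \<longleftrightarrow>
      {z, z'} \<in> image Inl ` joints T \<or> {z, z'} \<in> image Inr ` joints T' \<or>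
      (\<exists>p q. {z, z'} = {Inl p, Inr q} \<and> (p, q) \<in> set (zip (endpoints T) (endpoints T')))"
    by (simp add: glue_def disj_assoc)
  moreover have "{z, z'} \<in> edges (glue T T') \<longleftrightarrow>
      {z, z'} \<in> image Inl ` edges T \<or> {z, z'} \<in> image Inr ` edges T'"
    by (simp add: glue_def)
  moreover have "(z, z') \<in> strand_rel (glue T T') \<longleftrightarrow>
      {z, z'} \<in> edges (glue T T') \<or> {z, z'} \<in> joints (glue T T')"
    by (simp add: edge_rel_def joint_rel_def)
  moreover have "(a, b) \<in> strand_rel U \<longleftrightarrow> {a, b} \<in> edges U \<or> {a, b} \<in> joints U"
    for a b and U :: "'c tangle"
    by (simp add: edge_rel_def joint_rel_def)
  ultimately show ?thesis
    unfolding pair_mem_image_iff[OF inj_Inl] pair_mem_image_iff[OF inj_Inr]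
    by (simp add: edge_rel_def joint_rel_def ex_disj_distrib conj_disj_distribL disj_ac)
qed

text \<open>A circle of the glued diagram either avoids the gluing joints, and is a closed strand of
  one tangle, or is determined by the positions that it passes through. These form a class of the
  join of the two partitions.\<close>

lemma num_circles_glue:
  assumes T: "tangle_diagram n T" and T': "tangle_diagram n T'"
  shows "num_circles (glue T T') = loops T + loops T' + num_classes {..<2 * n} (ends T \<union> ends T')"
proof -
  let ?p = "\<lambda>i. endpoints T ! i" and ?q = "\<lambda>i. endpoints T' ! i"
  let ?R = "strand_rel T" and ?R' = "strand_rel T'" and ?G = "gen (strand_rel (glue T T'))"
  let ?I = "{..<2 * n}" and ?E = "ends T \<union> ends T'"
  have len: "length (endpoints T) = 2 * n" "length (endpoints T') = 2 * n"
    using T T' by (auto simp: tangle_diagram_def)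
  have fin: "finite (darts T)" "finite (darts T')" using T T' by (auto simp: tangle_diagram_def)
  have pH: "?p i \<in> darts T" "?q i \<in> darts T'" if "i \<in> ?I" for i
    using T T' len that by (auto simp: tangle_diagram_def)
  have darts: "darts (glue T T') = Inl ` darts T \<union> Inr ` darts T'"
    by (auto simp: darts_def glue_def)
  have G1: "(Inl x, Inl y) \<in> ?G" if "(x, y) \<in> gen ?R" for x y
    using that
  proof (rule gen_map[where f = Inl])
    show "(Inl a, Inl b) \<in> ?G" if "(a, b) \<in> ?R" for a b
      by (rule gen_base, rule strand_rel_glue[OF len, THEN iffD2]) (use that in blast)
  qed
  have G2: "(Inr x, Inr y) \<in> ?G" if "(x, y) \<in> gen ?R'" for x y
    using that
  proof (rule gen_map[where f = Inr])
    show "(Inr a, Inr b) \<in> ?G" if "(a, b) \<in> ?R'" for a b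
      by (rule gen_base, rule strand_rel_glue[OF len, THEN iffD2]) (use that in blast)
  qed
  have G3: "(Inr (?q i), Inl (?p i)) \<in> ?G" if "i \<in> ?I" for i
    by (rule gen_base, rule strand_rel_glue[OF len, THEN iffD2]) (use that in auto)
  have G4: "(Inl (?p i), Inl (?p j)) \<in> ?G" if "(i, j) \<in> gen ?E" for i j
    using that
  proof (rule gen_map)
    fix i j assume "(i, j) \<in> ?E"
    then show "(Inl (?p i), Inl (?p j)) \<in> ?G"
    proof
      assume "(i, j) \<in> ends T"
      then show ?thesis by (intro G1) (simp add: ends_def)
    next
      assume "(i, j) \<in> ends T'"
      then have ij: "i \<in> ?I" "j \<in> ?I" "(?q i, ?q j) \<in> gen ?R'" by (simp_all add: ends_def len)
      show ?thesis
        using gen_trans[OF gen_trans[OF gen_sym[OF G3[OF ij(1)]] G2[OF ij(3)]] G3[OF ij(2)]] .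
    qed
  qed

  \<comment> \<open>The positions reached by the strand through \<open>z\<close>. Closed strands
    reach none and are labelled by their own class, through \<open>base\<close>.\<close>
  define hit where "hit z = (case z of Inl x \<Rightarrow> {i \<in> ?I. (x, ?p i) \<in> gen ?R}
    | Inr y \<Rightarrow> {i \<in> ?I. (y, ?q i) \<in> gen ?R'})" for z
  define base where "base z = (case z of Inl x \<Rightarrow> Inl {y \<in> darts T. (x, y) \<in> gen ?R}
    | Inr x \<Rightarrow> Inr {y \<in> darts T'. (x, y) \<in> gen ?R'})" for z
  define cls where "cls i = {j \<in> ?I. (i, j) \<in> gen ?E}" for i
  \<comment> \<open>All positions of one strand lie in the same class, so the union is that single
    class; a union is taken to avoid choosing a position.\<close>
  define f where "f z = (if hit z = {} then Inl (base z) else Inr (\<Union>(cls ` hit z)))" for z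
  have cls_eq: "cls i = cls j" if "(i, j) \<in> gen ?E" for i j
    using that gen_sym[OF that] by (auto simp: cls_def intro: gen_trans)
  have hit_rel: "(i, j) \<in> gen ?E" if "i \<in> hit z" "j \<in> hit z" for i j z
  proof (cases z)
    case (Inl x)
    then have "(?p i, ?p j) \<in> gen ?R" using that by (auto simp: hit_def intro: gen_trans gen_sym)
    then show ?thesis using that by (intro gen_base) (auto simp: ends_def len hit_def Inl)
  next
    case (Inr x)
    then have "(?q i, ?q j) \<in> gen ?R'" using that by (auto simp: hit_def intro: gen_trans gen_sym)
    then show ?thesis using that by (intro gen_base) (auto simp: ends_def len hit_def Inr)
  qed
  have f_hit: "f z = Inr (cls i)" if "i \<in> hit z" for z i
  proof -
    have "cls j = cls i" if "j \<in> hit z" for j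
      using hit_rel[OF that \<open>i \<in> hit z\<close>] by (rule cls_eq)
    then have "cls ` hit z = {cls i}" using that by blast
    then have "\<Union>(cls ` hit z) = cls i" by simp
    moreover have "hit z \<noteq> {}" using that by blast
    ultimately show ?thesis by (simp add: f_def)
  qed
  have glued: "f (Inl (?p i)) = f (Inr (?q i))" if "i < 2 * n" for i
  proof -
    have "i \<in> hit (Inl (?p i))" "i \<in> hit (Inr (?q i))" using that by (auto simp: hit_def)
    then show ?thesis by (simp add: f_hit)
  qed
  have invariant: "f z = f z'" if zz: "(z, z') \<in> strand_rel (glue T T')" for z z'
  proof -
    consider (1) a b where "z = Inl a" "z' = Inl b" "(a, b) \<in> ?R"
      | (2) a b where "z = Inr a" "z' = Inr b" "(a, b) \<in> ?R'"
      | (3) i where "i < 2 * n" "z = Inl (?p i)" "z' = Inr (?q i)"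
      | (4) i where "i < 2 * n" "z' = Inl (?p i)" "z = Inr (?q i)"
      using strand_rel_glue[OF len, THEN iffD1, OF zz] by blast
    then show ?thesis
    proof cases
      case 1
      then have "(a, b) \<in> gen ?R" "(b, a) \<in> gen ?R" by (auto intro: gen_base gen_sym)
      then have "hit z = hit z'" "base z = base z'"
        by (auto simp: hit_def base_def 1(1,2) intro: gen_trans)
      then show ?thesis by (simp add: f_def)
    next
      case 2
      then have "(a, b) \<in> gen ?R'" "(b, a) \<in> gen ?R'" by (auto intro: gen_base gen_sym)
      then have "hit z = hit z'" "base z = base z'"
        by (auto simp: hit_def base_def 2(1,2) intro: gen_trans)
      then show ?thesis by (simp add: f_def)
    next
      case 3
      then show ?thesis using glued[of i] by simp
    next
      case 4
      then show ?thesis using glued[of i] by simp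
    qed
  qed
  have to_p: "(z, Inl (?p i)) \<in> ?G" if "i \<in> hit z" for z i
    using that by (cases z) (auto simp: hit_def intro: G1 gen_trans[OF G2 G3])
  have connected: "(z, z') \<in> ?G" if z: "z \<in> darts (glue T T')" "z' \<in> darts (glue T T')" "f z = f z'" for z z'
  proof (cases "hit z = {}")
    case True
    then have "hit z' = {}" "base z = base z'" using z(3) by (auto simp: f_def split: if_splits)
    note base = this(2)
    show ?thesis
    proof (cases z)
      case (Inl x)
      then obtain y where y: "z' = Inl y" using base by (cases z') (auto simp: base_def)
      then have "{u \<in> darts T. (x, u) \<in> gen ?R} = {u \<in> darts T. (y, u) \<in> gen ?R}" "y \<in> darts T"
        using base z(2) by (auto simp: base_def Inl darts)
      then have "(x, y) \<in> gen ?R" using gen_refl[of y ?R] by blast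
      then show ?thesis unfolding Inl y by (rule G1)
    next
      case (Inr x)
      then obtain y where y: "z' = Inr y" using base by (cases z') (auto simp: base_def)
      then have "{u \<in> darts T'. (x, u) \<in> gen ?R'} = {u \<in> darts T'. (y, u) \<in> gen ?R'}" "y \<in> darts T'"
        using base z(2) by (auto simp: base_def Inr darts)
      then have "(x, y) \<in> gen ?R'" using gen_refl[of y ?R'] by blast
      then show ?thesis unfolding Inr y by (rule G2)
    qed
  next
    case False
    then obtain i where i: "i \<in> hit z" by blast
    then have "hit z' \<noteq> {}" using z(3) by (auto simp: f_def split: if_splits)
    then obtain j where j: "j \<in> hit z'" by blast
    have "cls i = cls j" using z(3) by (simp add: f_hit[OF i] f_hit[OF j])
    moreover have "j \<in> cls j" using j by (cases z') (auto simp: hit_def cls_def)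
    ultimately have "(i, j) \<in> gen ?E" unfolding cls_def by blast
    from gen_trans[OF gen_trans[OF to_p[OF i] G4[OF this]] gen_sym[OF to_p[OF j]]]
    show ?thesis .
  qed
  have "num_circles (glue T T') = card (f ` darts (glue T T'))"
    unfolding num_circles_def
  proof (rule num_classes_eqI)
    show "f x = f y \<longleftrightarrow> (x, y) \<in> ?G" if "x \<in> darts (glue T T')" "y \<in> darts (glue T T')" for x y
      using connected[OF that] gen_invariant[of x y _ f] invariant by blast
  qed
  define L where "L = {c \<in> classes (darts T) ?R. c \<inter> set (endpoints T) = {}}"
  define L' where "L' = {c \<in> classes (darts T') ?R'. c \<inter> set (endpoints T') = {}}"
  have ends_set: "set (endpoints T) = ?p ` ?I" "set (endpoints T') = ?q ` ?I"
    by (auto simp: len set_conv_nth)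
  have hit1: "hit (Inl x) = {} \<longleftrightarrow> {y \<in> darts T. (x, y) \<in> gen ?R} \<inter> set (endpoints T) = {}" for x
    using pH(1) by (auto simp: hit_def ends_set)
  have hit2: "hit (Inr x) = {} \<longleftrightarrow> {y \<in> darts T'. (x, y) \<in> gen ?R'} \<inter> set (endpoints T') = {}" for x
    using pH(2) by (auto simp: hit_def ends_set)
  have "f ` darts (glue T T') = Inl ` (Inl ` L \<union> Inr ` L') \<union> Inr ` classes ?I ?E"
  proof (intro equalityI subsetI)
    fix v assume "v \<in> f ` darts (glue T T')"
    then obtain z where z: "z \<in> darts (glue T T')" "v = f z" by blast
    show "v \<in> Inl ` (Inl ` L \<union> Inr ` L') \<union> Inr ` classes ?I ?E"
    proof (cases "hit z = {}")
      case True
      then have "v = Inl (base z)" by (simp add: z(2) f_def)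
      moreover have "base z \<in> Inl ` L \<union> Inr ` L'"
      proof (cases z)
        case (Inl x)
        then have "{y \<in> darts T. (x, y) \<in> gen ?R} \<in> L"
          using z(1) True hit1[of x] by (auto simp: L_def mem_classes_iff darts)
        then show ?thesis by (simp add: base_def Inl)
      next
        case (Inr x)
        then have "{y \<in> darts T'. (x, y) \<in> gen ?R'} \<in> L'"
          using z(1) True hit2[of x] by (auto simp: L'_def mem_classes_iff darts)
        then show ?thesis by (simp add: base_def Inr)
      qed
      ultimately show ?thesis by blast
    next
      case False
      then obtain i where i: "i \<in> hit z" by blast
      then have "i \<in> ?I" by (cases z) (auto simp: hit_def)
      then have "cls i \<in> classes ?I ?E" unfolding mem_classes_iff cls_def by blast
      then show ?thesis using f_hit[OF i] z(2) by blast
    qed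
  next
    fix v assume "v \<in> Inl ` (Inl ` L \<union> Inr ` L') \<union> Inr ` classes ?I ?E"
    then consider (1) c where "v = Inl (Inl c)" "c \<in> L" | (2) c where "v = Inl (Inr c)" "c \<in> L'"
      | (3) c where "v = Inr c" "c \<in> classes ?I ?E" by blast
    then show "v \<in> f ` darts (glue T T')"
    proof cases
      case 1
      then obtain x where x: "x \<in> darts T" "c = {y \<in> darts T. (x, y) \<in> gen ?R}" "c \<inter> set (endpoints T) = {}"
        unfolding L_def mem_classes_iff by blast
      then have "f (Inl x) = v" using hit1[of x] 1 by (simp add: f_def base_def)
      then show ?thesis using x(1) darts by blast
    next
      case 2
      then obtain x where x: "x \<in> darts T'" "c = {y \<in> darts T'. (x, y) \<in> gen ?R'}" "c \<inter> set (endpoints T') = {}"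
        unfolding L'_def mem_classes_iff by blast
      then have "f (Inr x) = v" using hit2[of x] 2 by (simp add: f_def base_def)
      then show ?thesis using x(1) darts by blast
    next
      case 3
      then obtain i where i: "i \<in> ?I" "c = cls i" unfolding mem_classes_iff cls_def by blast
      then have "i \<in> hit (Inl (?p i))" by (simp add: hit_def)
      then have "f (Inl (?p i)) = v" using 3 i f_hit by blast
      then show ?thesis using pH(1)[OF i(1)] darts by blast
    qed
  qed
  moreover have "finite L" "finite L'" "finite (classes ?I ?E)"
    using fin by (auto simp: L_def L'_def quotient_def)
  ultimately have "card (f ` darts (glue T T')) = card L + card L' + card (classes ?I ?E)"
    by (simp only: card_Plus finite_Plus flip: Plus_def)
  then show ?thesis
    using \<open>num_circles (glue T T') = _\<close> by (simp add: loops_def L_def L'_def num_classes_gen)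
qed

lemma num_classes_pos:
  assumes "finite H" "x \<in> H"
  shows "num_classes H R > 0"
proof -
  have "{y \<in> H. (x, y) \<in> gen R} \<in> classes H R"
    unfolding mem_classes_iff using assms(2) by blast
  then have "classes H R \<noteq> {}" by (rule ex_in_conv[THEN iffD1, OF exI])
  moreover have "finite (classes H R)" using assms(1) by (simp add: quotient_def)
  ultimately show ?thesis unfolding num_classes_gen card_gt_0_iff by (rule conjI)
qed

text \<open>Every closed strand counts with a full factor \<open>loop_value\<close>. The
  normalization of the bracket, one factor fewer than circles, is charged to the circles through the
  boundary.\<close>

definition state_weight :: "'d tangle \<Rightarrow> ('d \<times> 'd \<times> 'd \<times> 'd) set \<Rightarrow> laurent" where
  "state_weight T S =
     A_pow (int (card (crossings T)) - 2 * int (card S)) * loop_value ^ loops (smoothing S T)"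

lemma finite_crossings:
  assumes "tangle_diagram n T"
  shows "finite (crossings T)"
proof -
  have "crossings T \<subseteq> darts T \<times> darts T \<times> darts T \<times> darts T"
    using assms by (force simp: tangle_diagram_def corners_def)
  moreover have "finite (darts T)" using assms unfolding tangle_diagram_def by blast
  ultimately show ?thesis by (meson finite_SigmaI finite_subset)
qed

text \<open>The weights depend on one tangle each; the tangles interact only through the circles
  formed by their two connectivity relations.\<close>

lemma bracket_glue:
  assumes T: "tangle_diagram n T" and T': "tangle_diagram n T'" and "n > 0"
  shows "bracket (glue T T') =
    (\<Sum>S\<in>Pow (crossings T). \<Sum>S'\<in>Pow (crossings T'). state_weight T S * state_weight T' S' *
       loop_value ^ (num_classes {..<2 * n} (ends (smoothing S T) \<union> ends (smoothing S' T')) - 1))"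
    (is "_ = (\<Sum>S\<in>_. \<Sum>S'\<in>_. ?h S S')")
proof -
  let ?C = "crossings T" and ?C' = "crossings T'"
  let ?u = "\<lambda>(S, S'). map_crossing Inl ` S \<union> map_crossing Inr ` S'"
  let ?g = "\<lambda>X. A_pow (int (card (crossings (glue T T'))) - 2 * int (card X)) *
    loop_value ^ (num_circles (smoothing X (glue T T')) - 1)"
  have fin: "finite ?C" "finite ?C'" using T T' finite_crossings by auto
  have crossings: "crossings (glue T T') = ?u (?C, ?C')" by (simp add: glue_def)
  have card_u: "card (?u (S, S')) = card S + card S'" if "finite S" "finite S'" for S S'
    using card_glue_states[OF that] by simp
  have "bij_betw ?u (Pow ?C \<times> Pow ?C') (Pow (crossings (glue T T')))"
  proof (rule bij_betw_byWitness[where f' = "\<lambda>X. (map_crossing Inl -` X, map_crossing Inr -` X)"])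
    show "\<forall>a\<in>Pow ?C \<times> Pow ?C'. (map_crossing Inl -` ?u a, map_crossing Inr -` ?u a) = a"
      by auto
    show "\<forall>a'\<in>Pow (crossings (glue T T')). ?u (map_crossing Inl -` a', map_crossing Inr -` a') = a'"
      unfolding crossings by auto
    show "?u ` (Pow ?C \<times> Pow ?C') \<subseteq> Pow (crossings (glue T T'))"
      unfolding crossings by auto
    show "(\<lambda>X. (map_crossing Inl -` X, map_crossing Inr -` X)) ` Pow (crossings (glue T T')) \<subseteq> Pow ?C \<times> Pow ?C'"
      unfolding crossings by auto
  qed
  then have "(\<Sum>X\<in>Pow (crossings (glue T T')). ?g X) = (\<Sum>P\<in>Pow ?C \<times> Pow ?C'. ?g (?u P))"
    by (rule sum.reindex_bij_betw[symmetric])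
  also have "\<dots> = (\<Sum>(S, S')\<in>Pow ?C \<times> Pow ?C'. ?h S S')"
  proof (rule sum.cong[OF refl])
    fix P assume P: "P \<in> Pow ?C \<times> Pow ?C'"
    obtain S S' where SS: "P = (S, S')" by (cases P)
    then have finS: "finite S" "finite S'" using P fin by (auto intro: finite_subset)
    let ?k = "num_classes {..<2 * n} (ends (smoothing S T) \<union> ends (smoothing S' T'))"
    \<comment> \<open>Some circle passes through position 0, so the truncated subtraction of 1 can
      be moved from the total number of circles to \<open>?k\<close>.\<close>
    have k: "?k > 0" using \<open>n > 0\<close> by (intro num_classes_pos[of _ 0]) simp_all
    have "num_circles (smoothing (?u P) (glue T T')) - 1 =
        loops (smoothing S T) + loops (smoothing S' T') + (?k - 1)"
      using k num_circles_glue[OF tangle_diagram_smoothing[OF T] tangle_diagram_smoothing[OF T'], of S S']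
      by (simp add: SS smoothing_glue)
    moreover have "A_pow (int (card (crossings (glue T T'))) - 2 * int (card (?u P))) =
        A_pow (int (card ?C) - 2 * int (card S)) * A_pow (int (card ?C') - 2 * int (card S'))"
      unfolding SS crossings card_u[OF fin] card_u[OF finS] A_pow_add[symmetric]
      by (simp add: algebra_simps)
    ultimately show "?g (?u P) = (case P of (S, S') \<Rightarrow> ?h S S')"
      by (simp add: SS state_weight_def power_add mult_ac)
  qed
  also have "\<dots> = (\<Sum>S\<in>Pow ?C. \<Sum>S'\<in>Pow ?C'. ?h S S')"
    by (rule sum.cartesian_product[symmetric])
  finally show ?thesis
    using bracket_state_sum[of "glue T T'"] fin by (simp add: crossings)
qed

section \<open>The writhe of a glued diagram\<close>

lemma crossing_sign_glue [simp]:
  "crossing_sign (glue T T') (map_crossing Inl x) = crossing_sign T x"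
  "crossing_sign (glue T T') (map_crossing Inr y) = crossing_sign T' y"
  by (auto simp: crossing_sign_def map_crossing_def glue_def image_iff split: prod.splits)

lemma writhe_glue:
  assumes "finite (crossings T)" "finite (crossings T')"
  shows "writhe (glue T T') = writhe T + writhe T'"
proof -
  have "writhe (glue T T') = (\<Sum>x\<in>map_crossing Inl ` crossings T \<union> map_crossing Inr ` crossings T'.
      crossing_sign (glue T T') x)"
    by (simp add: writhe_def glue_def)
  also have "\<dots> = writhe T + writhe T'"
  proof (subst sum.union_disjoint)
    show "(\<Sum>x\<in>map_crossing Inl ` crossings T. crossing_sign (glue T T') x) +
        (\<Sum>x\<in>map_crossing Inr ` crossings T'. crossing_sign (glue T T') x) = writhe T + writhe T'"
      by (simp add: writhe_def sum.reindex[OF inj_on_subset[OF inj_map_crossing subset_UNIV]])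
  qed (use assms in auto)
  finally show ?thesis .
qed

section \<open>The five matchings of six endpoints\<close>

text \<open>The list is an involution of the positions, sending \<open>i\<close> to
  \<open>l ! i\<close>; the diagonal is added to agree with \<open>ends\<close>.\<close>

definition chords :: "nat list \<Rightarrow> (nat \<times> nat) set" where
  "chords l = {(i, j). i < length l \<and> (j = i \<or> j = l ! i)}"

text \<open>Five is the third Catalan number. In order: a1, a2, and the three matchings with a
  diameter, {0, 3}, {1, 4} and {2, 5}. The half turn keeps a diameter and exchanges the two short
  chords beside it.\<close>

definition noncrossing_matchings :: "nat list set" where
  "noncrossing_matchings =
     {[1, 0, 3, 2, 5, 4], [5, 2, 1, 4, 3, 0], [3, 2, 1, 0, 5, 4], [5, 4, 3, 2, 1, 0], [1, 0, 5, 4, 3, 2]}"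

lemma less_6_iff: "(i::nat) < 6 \<longleftrightarrow> i = 0 \<or> i = 1 \<or> i = 2 \<or> i = 3 \<or> i = 4 \<or> i = 5"
  by auto

text \<open>The positions on either side of a chord are matched among themselves, so their number is
  even. This excludes 2 and 4 as partners of 0, and what remains is a finite case analysis.\<close>

lemma noncrossing_involution:
  fixes f :: "nat \<Rightarrow> nat"
  assumes f: "\<And>i. i < 6 \<Longrightarrow> f i < 6 \<and> f i \<noteq> i \<and> f (f i) = i"
    and nc: "\<And>i j k l. i < j \<Longrightarrow> j < k \<Longrightarrow> k < l \<Longrightarrow> l < 6 \<Longrightarrow> \<not> (f i = k \<and> f j = l)"
  shows "[f 0, f 1, f 2, f 3, f 4, f 5] \<in> noncrossing_matchings"
proof -
  have f0: "f 0 \<in> {1, 2, 3, 4, 5}" using f[of 0] by (auto simp: less_6_iff)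
  have f1: "f 1 \<in> {0, 2, 3, 4, 5}" using f[of 1] by (auto simp: less_6_iff)
  have f2: "f 2 \<in> {0, 1, 3, 4, 5}" using f[of 2] by (auto simp: less_6_iff)
  have f3: "f 3 \<in> {0, 1, 2, 4, 5}" using f[of 3] by (auto simp: less_6_iff)
  have f4: "f 4 \<in> {0, 1, 2, 3, 5}" using f[of 4] by (auto simp: less_6_iff)
  have f5: "f 5 \<in> {0, 1, 2, 3, 4}" using f[of 5] by (auto simp: less_6_iff)
  have flip: "f j = i" if "f i = j" "i < 6" for i j using f[of i] that by auto
  have ne: "f i \<noteq> j" if "f j \<noteq> i" "i < 6" for i j using f[of i] that by auto
  consider "f 0 = 1" | "f 0 = 2" | "f 0 = 3" | "f 0 = 4" | "f 0 = 5" using f0 by auto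
  then show ?thesis
  proof cases
    case 1
    then have f10: "f 1 = 0" by (rule flip) simp
    have "f 2 \<noteq> 0 \<and> f 2 \<noteq> 1" by (intro conjI; rule ne; use 1 f10 in simp)
    then consider "f 2 = 3" | "f 2 = 4" | "f 2 = 5" using f2 by auto
    then show ?thesis
    proof cases
      case a: 1
      have f32: "f 3 = 2" using a by (rule flip) simp
      have "f 4 \<noteq> 0 \<and> f 4 \<noteq> 1 \<and> f 4 \<noteq> 2 \<and> f 4 \<noteq> 3" by (intro conjI; rule ne; use 1 f10 a f32 in simp)
      then have f45: "f 4 = 5" using f4 by auto
      then have "f 5 = 4" by (rule flip) simp
      then show ?thesis using 1 f10 a f32 f45 by (simp add: noncrossing_matchings_def)
    next
      case a: 2
      have f42: "f 4 = 2" using a by (rule flip) simp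
      have "f 3 \<noteq> 0 \<and> f 3 \<noteq> 1 \<and> f 3 \<noteq> 2 \<and> f 3 \<noteq> 4" by (intro conjI; rule ne; use 1 f10 a f42 in simp)
      then have "f 3 = 5" using f3 by auto
      then show ?thesis using nc[of 2 3 4 5] a by simp
    next
      case a: 3
      have f52: "f 5 = 2" using a by (rule flip) simp
      have "f 3 \<noteq> 0 \<and> f 3 \<noteq> 1 \<and> f 3 \<noteq> 2 \<and> f 3 \<noteq> 5" by (intro conjI; rule ne; use 1 f10 a f52 in simp)
      then have f34: "f 3 = 4" using f3 by auto
      then have "f 4 = 3" by (rule flip) simp
      then show ?thesis using 1 f10 a f52 f34 by (simp add: noncrossing_matchings_def)
    qed
  next
    \<comment> \<open>Position 1 would be alone on its side of the chord {0, 2}; below, position 5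
      is alone beside {0, 4}.\<close>
    case 2
    then have f20: "f 2 = 0" by (rule flip) simp
    have "f 1 \<noteq> 0 \<and> f 1 \<noteq> 2" by (intro conjI; rule ne; use 2 f20 in simp)
    then have "f 1 = 3 \<or> f 1 = 4 \<or> f 1 = 5" using f1 by auto
    then show ?thesis using nc[of 0 1 2 3] nc[of 0 1 2 4] nc[of 0 1 2 5] 2 by simp
  next
    case 3
    then have f30: "f 3 = 0" by (rule flip) simp
    have "f 1 \<noteq> 0 \<and> f 1 \<noteq> 3" by (intro conjI; rule ne; use 3 f30 in simp)
    moreover have "f 1 \<noteq> 4" "f 1 \<noteq> 5" using nc[of 0 1 3 4] nc[of 0 1 3 5] 3 by simp_all
    ultimately have f12: "f 1 = 2" using f1 by auto
    then have f21: "f 2 = 1" by (rule flip) simp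
    have "f 4 \<noteq> 0 \<and> f 4 \<noteq> 1 \<and> f 4 \<noteq> 2 \<and> f 4 \<noteq> 3" by (intro conjI; rule ne; use 3 f30 f12 f21 in simp)
    then have f45: "f 4 = 5" using f4 by auto
    then have "f 5 = 4" by (rule flip) simp
    then show ?thesis using 3 f30 f12 f21 f45 by (simp add: noncrossing_matchings_def)
  next
    case 4
    then have f40: "f 4 = 0" by (rule flip) simp
    have "f 5 \<noteq> 0 \<and> f 5 \<noteq> 4" by (intro conjI; rule ne; use 4 f40 in simp)
    then consider "f 5 = 1" | "f 5 = 2" | "f 5 = 3" using f5 by auto
    then have "f 1 = 5 \<or> f 2 = 5 \<or> f 3 = 5" by cases (use flip[of 5] in auto)
    then show ?thesis using nc[of 0 1 4 5] nc[of 0 2 4 5] nc[of 0 3 4 5] 4 by auto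
  next
    case 5
    then have f50: "f 5 = 0" by (rule flip) simp
    have "f 1 \<noteq> 0 \<and> f 1 \<noteq> 5" by (intro conjI; rule ne; use 5 f50 in simp)
    then consider "f 1 = 2" | "f 1 = 3" | "f 1 = 4" using f1 by auto
    then show ?thesis
    proof cases
      case a: 1
      have f21: "f 2 = 1" using a by (rule flip) simp
      have "f 3 \<noteq> 0 \<and> f 3 \<noteq> 1 \<and> f 3 \<noteq> 2 \<and> f 3 \<noteq> 5" by (intro conjI; rule ne; use 5 f50 a f21 in simp)
      then have f34: "f 3 = 4" using f3 by auto
      then have "f 4 = 3" by (rule flip) simp
      then show ?thesis using 5 f50 a f21 f34 by (simp add: noncrossing_matchings_def)
    next
      case a: 2
      have f31: "f 3 = 1" using a by (rule flip) simp
      have "f 2 \<noteq> 0 \<and> f 2 \<noteq> 1 \<and> f 2 \<noteq> 3 \<and> f 2 \<noteq> 5" by (intro conjI; rule ne; use 5 f50 a f31 in simp)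
      then have "f 2 = 4" using f2 by auto
      then show ?thesis using nc[of 1 2 3 4] a by simp
    next
      case a: 3
      have f41: "f 4 = 1" using a by (rule flip) simp
      have "f 2 \<noteq> 0 \<and> f 2 \<noteq> 1 \<and> f 2 \<noteq> 4 \<and> f 2 \<noteq> 5" by (intro conjI; rule ne; use 5 f50 a f41 in simp)
      then have f23: "f 2 = 3" using f2 by auto
      then have "f 3 = 2" by (rule flip) simp
      then show ?thesis using 5 f50 a f41 f23 by (simp add: noncrossing_matchings_def)
    qed
  qed
qed

text \<open>The second assumption is the noncrossing condition for partitions. Here each block
  consists of the two ends of a strand, so its conclusion is absurd and no two pairs can
  interleave.\<close>

lemma ends_state:
  assumes T: "tangle_diagram 3 T"
    and nc: "\<And>i j k l. i < j \<Longrightarrow> j < k \<Longrightarrow> k < l \<Longrightarrow> l < 6 \<Longrightarrow>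
      (i, k) \<in> ends (smoothing S T) \<Longrightarrow> (j, l) \<in> ends (smoothing S T) \<Longrightarrow> (i, j) \<in> ends (smoothing S T)"
  shows "ends (smoothing S T) \<in> chords ` noncrossing_matchings"
proof -
  let ?U = "smoothing S T" and ?p = "\<lambda>i. endpoints T ! i"
  let ?E = "ends ?U"
  have U: "tangle_diagram 3 ?U" using T by (rule tangle_diagram_smoothing)
  have len: "length (endpoints T) = 6" and dist: "distinct (endpoints T)"
    using T by (auto simp: tangle_diagram_def)
  have E: "(i, j) \<in> ?E \<longleftrightarrow> i < 6 \<and> j < 6 \<and> (?p i, ?p j) \<in> gen (strand_rel ?U)" for i j
    by (simp add: ends_def len)
  have refl: "(i, i) \<in> ?E" if "i < 6" for i using that by (simp add: E)
  have sym: "(j, i) \<in> ?E" if "(i, j) \<in> ?E" for i j using that by (auto simp: E intro: gen_sym)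
  have ex1: "\<exists>!j. j \<noteq> i \<and> (i, j) \<in> ?E" if "i < 6" for i
  proof -
    have "?p i \<in> set (endpoints ?U)" using that len by simp
    then have ex1: "\<exists>!q. q \<in> set (endpoints T) \<and> q \<noteq> ?p i \<and> (?p i, q) \<in> gen (strand_rel ?U)"
      using strand_ends[OF U] by simp
    then obtain q where q: "q \<in> set (endpoints T)" "q \<noteq> ?p i" "(?p i, q) \<in> gen (strand_rel ?U)"
      by (elim ex1E conjE)
    have unique: "q' = q" if "q' \<in> set (endpoints T)" "q' \<noteq> ?p i" "(?p i, q') \<in> gen (strand_rel ?U)" for q'
      by (rule ex1E[OF ex1]) (use q that in metis)
    obtain j where j: "j < 6" "q = ?p j"
      using q(1) len by (auto simp: in_set_conv_nth)
    show ?thesis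
    proof (rule ex1I[of _ j])
      show "j \<noteq> i \<and> (i, j) \<in> ?E" using q j that by (auto simp: E)
      fix k assume k: "k \<noteq> i \<and> (i, k) \<in> ?E"
      then have "k < 6" by (simp add: E)
      then have "?p k \<noteq> ?p i" using k that dist len by (simp add: nth_eq_iff_index_eq)
      then have "?p k = ?p j" using unique[of "?p k"] k j len by (simp add: E)
      then show "k = j" using \<open>k < 6\<close> j(1) dist len by (simp add: nth_eq_iff_index_eq)
    qed
  qed
  define f where "f i = (THE j. j \<noteq> i \<and> (i, j) \<in> ?E)" for i
  have f: "f i \<noteq> i" "(i, f i) \<in> ?E" if "i < 6" for i
    using theI'[OF ex1[OF that]] by (simp_all add: f_def)
  have f_unique: "j = f i" if "i < 6" "j \<noteq> i" "(i, j) \<in> ?E" for i j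
    using ex1[OF that(1)] f[OF that(1)] that by blast
  have f6: "f i < 6" if "i < 6" for i using f(2)[OF that] by (simp add: E)
  have ff: "f (f i) = i" if "i < 6" for i
    using f_unique[OF f6[OF that], of i] f[OF that] sym by simp
  let ?l = "[f 0, f 1, f 2, f 3, f 4, f 5]"
  have nth: "?l ! i = f i" if "i < 6" for i using that by (auto simp: less_6_iff)
  have "?l \<in> noncrossing_matchings"
  proof (rule noncrossing_involution)
    show "f i < 6 \<and> f i \<noteq> i \<and> f (f i) = i" if "i < 6" for i
      using f6 f ff that by simp
    show "\<not> (f i = k \<and> f j = l)" if ijkl: "i < j" "j < k" "k < l" "l < 6" for i j k l
    proof
      assume fkl: "f i = k \<and> f j = l"
      then have "(i, k) \<in> ?E" "(j, l) \<in> ?E" using f(2)[of i] f(2)[of j] ijkl by auto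
      then have "(i, j) \<in> ?E" using nc ijkl by blast
      then have "j = f i" using f_unique[of i j] ijkl by simp
      then show False using fkl ijkl by simp
    qed
  qed
  moreover have "?E = chords ?l"
  proof (intro equalityI subrelI)
    fix i j assume ij: "(i, j) \<in> ?E"
    then have "i < 6" by (simp add: E)
    moreover from this have "j = i \<or> j = ?l ! i" using f_unique[of i j] ij nth by metis
    ultimately show "(i, j) \<in> chords ?l" by (simp add: chords_def)
  next
    fix i j assume "(i, j) \<in> chords ?l"
    then have "i < 6" "j = i \<or> j = ?l ! i" by (simp_all add: chords_def)
    then show "(i, j) \<in> ?E" using f(2) refl nth by metis
  qed
  ultimately show ?thesis by blast
qed

lemma ends_state_classical:
  assumes "classical_tangle 3 T"
  shows "ends (smoothing S T) \<in> chords ` noncrossing_matchings"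
proof (rule ends_state)
  have T: "tangle_diagram 3 T" "planar (endpoints T) T"
    using assms by (simp_all add: classical_tangle_def)
  then have len: "length (endpoints T) = 6" and dist: "distinct (endpoints T)"
    by (auto simp: tangle_diagram_def)
  show "tangle_diagram 3 T" by fact
  show "(i, j) \<in> ends (smoothing S T)" if "i < j" "j < k" "k < l" "l < 6"
    "(i, k) \<in> ends (smoothing S T)" "(j, l) \<in> ends (smoothing S T)" for i j k l
    using strands_noncrossing[OF T dist refl that(1,2,3), of S] that len by (simp add: ends_def)
qed

lemma ends_state_complementary:
  assumes "classical_complementary_tangle 3 T"
  shows "ends (smoothing S T) \<in> chords ` noncrossing_matchings"
proof (rule ends_state)
  let ?p = "\<lambda>i. endpoints T ! i" and ?G = "gen (strand_rel (smoothing S T))"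
  have T: "tangle_diagram 3 T" "planar (rev (endpoints T)) T"
    using assms by (simp_all add: classical_complementary_tangle_def)
  then have len: "length (endpoints T) = 6" and dist: "distinct (rev (endpoints T))"
    by (auto simp: tangle_diagram_def)
  \<comment> \<open>Reversal of the list is the reflection of \<open>i\<close> to
    \<open>5 - i\<close>, so an increasing quadruple has to be presented in the opposite
    order.\<close>
  have rev: "rev (endpoints T) ! (5 - i) = ?p i" if "i < 6" for i
    using that len by (simp add: rev_nth)
  show "tangle_diagram 3 T" by fact
  show "(i, j) \<in> ends (smoothing S T)" if ijkl: "i < j" "j < k" "k < l" "l < 6"
    and "(i, k) \<in> ends (smoothing S T)" "(j, l) \<in> ends (smoothing S T)" for i j k l
  proof -
    have ik: "(?p k, ?p i) \<in> ?G" and jl: "(?p l, ?p j) \<in> ?G"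
      using that by (auto simp: ends_def intro: gen_sym)
    have "(rev (endpoints T) ! (5 - l), rev (endpoints T) ! (5 - k)) \<in> ?G"
      by (rule strands_noncrossing[OF T dist, of "5 - l" "5 - k" "5 - j" "5 - i"])
        (use ijkl len ik jl in \<open>simp_all add: rev\<close>)
    then have "(?p l, ?p k) \<in> ?G" using ijkl by (simp add: rev)
    \<comment> \<open>The reflected statement connects \<open>l\<close> with \<open>k\<close>; the
      chain \<open>i\<close>, \<open>k\<close>, \<open>l\<close>, \<open>j\<close> gives the
      connection that is wanted.\<close>
    then have "(?p i, ?p j) \<in> ?G"
      using gen_trans[OF gen_sym[OF ik] gen_trans[OF gen_sym[OF \<open>(?p l, ?p k) \<in> ?G\<close>] jl]] by simp
    then show ?thesis using ijkl by (simp add: ends_def len)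
  qed
qed

text \<open>On the five matchings this is 1 at \<open>a\<^sub>1\<close>, - 1 at \<open>a\<^sub>2\<close>, and 0 otherwise; endpoints are counted from 0.\<close>

definition rotation_sign :: "(nat \<times> nat) set \<Rightarrow> laurent" where
  "rotation_sign E = (if (0, 1) \<in> E \<and> (2, 3) \<in> E then 1 else if (1, 2) \<in> E \<and> (3, 4) \<in> E then - 1 else 0)"

text \<open>Position \<open>i\<close> of the turned tangle holds the former endpoint at
  \<open>i + 3\<close>. Since 3 = -3 modulo 6, the direction of the turn does not matter.\<close>

definition half_turn :: "(nat \<times> nat) set \<Rightarrow> (nat \<times> nat) set" where
  "half_turn E = {(i, j). i < 6 \<and> j < 6 \<and> ((i + 3) mod 6, (j + 3) mod 6) \<in> E}"

section \<open>Circles formed by two matchings\<close>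

abbreviation circles :: "(nat \<times> nat) set \<Rightarrow> (nat \<times> nat) set \<Rightarrow> nat" where
  "circles E E' \<equiv> num_classes {..<6} (E \<union> E')"

lemma num_classes_representatives:
  assumes "\<And>i. i \<in> H \<Longrightarrow> r i \<in> H \<and> (i, r i) \<in> gen R" and "\<And>i j. (i, j) \<in> R \<Longrightarrow> r i = r j"
  shows "num_classes H R = card (r ` H)"
proof (rule num_classes_eqI)
  show "r x = r y \<longleftrightarrow> (x, y) \<in> gen R" if "x \<in> H" "y \<in> H" for x y
  proof
    assume "r x = r y"
    then show "(x, y) \<in> gen R" using assms(1) that by (metis gen_sym gen_trans)
  next
    assume "(x, y) \<in> gen R"
    then show "r x = r y"
    proof (rule gen_invariant)
      show "r a = r b" if "(a, b) \<in> R" for a b using that by (rule assms(2))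
    qed
  qed
qed

text \<open>The word \<open>w i\<close> prescribes a walk along chords of \<open>l\<close> (\<open>True\<close>) and \<open>l'\<close> (\<open>False\<close>) from \<open>i\<close> to its
  representative \<open>r ! i\<close>.\<close>

lemma circles_chords:
  assumes l: "length l = 6" "length l' = 6" and r: "length r = 6"
    and inv: "\<And>i. i < 6 \<Longrightarrow> r ! (l ! i) = r ! i \<and> r ! (l' ! i) = r ! i"
    and rep: "\<And>i. i < 6 \<Longrightarrow> r ! i < 6 \<and> r ! i = fold (\<lambda>b j. if b then l ! j else l' ! j) (w i) i"
    and bd: "\<And>i. i < 6 \<Longrightarrow> l ! i < 6 \<and> l' ! i < 6"
  shows "circles (chords l) (chords l') = card (set r)"
proof -
  let ?G = "gen (chords l \<union> chords l')"
  let ?step = "\<lambda>b j. if b then l ! j else l' ! j"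
  have "i < 6 \<Longrightarrow> (i, fold ?step w i) \<in> ?G" for w i
  proof (induction w arbitrary: i)
    case (Cons b w)
    have "(i, ?step b i) \<in> ?G"
      using Cons.prems l by (intro gen_base) (auto simp: chords_def)
    moreover have "(?step b i, fold ?step w (?step b i)) \<in> ?G"
      using Cons bd by simp
    ultimately show ?case by (auto intro: gen_trans)
  qed simp
  note step = this
  have "circles (chords l) (chords l') = card ((!) r ` {..<6})"
  proof (rule num_classes_representatives)
    show "r ! i \<in> {..<6} \<and> (i, r ! i) \<in> ?G" if "i \<in> {..<6}" for i
      using rep[of i] step[of i "w i"] that by simp
    show "r ! i = r ! j" if "(i, j) \<in> chords l \<union> chords l'" for i j
      using that inv[of i] l by (auto simp: chords_def)
  qed
  also have "(!) r ` {..<6} = set r"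
    using r by (auto simp: set_conv_nth)
  finally show ?thesis .
qed

text \<open>The rows and columns of \<open>a1\<close> and \<open>a2\<close> in the meander matrix of
  the five matchings. Entries between \<open>b1\<close>, \<open>b2\<close>, \<open>b3\<close> are
  absent: the half turn fixes these matchings, so such terms cancel whatever their value.\<close>

lemma circles_table:
  defines "a1 \<equiv> chords [1, 0, 3, 2, 5, 4]" and "a2 \<equiv> chords [5, 2, 1, 4, 3, 0]"
    and "b1 \<equiv> chords [3, 2, 1, 0, 5, 4]" and "b2 \<equiv> chords [5, 4, 3, 2, 1, 0]"
    and "b3 \<equiv> chords [1, 0, 5, 4, 3, 2]"
  shows "circles a1 a1 = 3" "circles a1 a2 = 1" "circles a2 a1 = 1" "circles a2 a2 = 3"
    "circles a1 b1 = 2" "circles a1 b2 = 2" "circles a1 b3 = 2"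
    "circles a2 b1 = 2" "circles a2 b2 = 2" "circles a2 b3 = 2"
    "circles b1 a1 = 2" "circles b2 a1 = 2" "circles b3 a1 = 2"
    "circles b1 a2 = 2" "circles b2 a2 = 2" "circles b3 a2 = 2"
proof -
  \<comment> \<open>In each list \<open>r\<close> a position is sent to the least position on its
    circle; the representatives themselves have empty words.\<close>
  show a1a1: "circles a1 a1 = 3"
    unfolding assms
    by (subst circles_chords[where r = "[0, 0, 2, 2, 4, 4]"
        and w = "(!) [[], [True], [], [True], [], [True]]"])
      (auto simp: less_6_iff card_insert_if)
  show a1a2: "circles a1 a2 = 1"
    unfolding assms
    by (subst circles_chords[where r = "[0, 0, 0, 0, 0, 0]"
        and w = "(!) [[], [True], [False, True], [True, False, True], [True, False], [False]]"])
      (auto simp: less_6_iff card_insert_if)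
  show a2a2: "circles a2 a2 = 3"
    unfolding assms
    by (subst circles_chords[where r = "[0, 1, 1, 3, 3, 0]"
        and w = "(!) [[], [], [True], [], [True], [True]]"])
      (auto simp: less_6_iff card_insert_if)
  show a1b1: "circles a1 b1 = 2"
    unfolding assms
    by (subst circles_chords[where r = "[0, 0, 0, 0, 4, 4]"
        and w = "(!) [[], [True], [True, False], [False], [], [True]]"])
      (auto simp: less_6_iff card_insert_if)
  show a1b2: "circles a1 b2 = 2"
    unfolding assms
    by (subst circles_chords[where r = "[0, 0, 2, 2, 0, 0]"
        and w = "(!) [[], [True], [], [True], [True, False], [False]]"])
      (auto simp: less_6_iff card_insert_if)
  show a1b3: "circles a1 b3 = 2"
    unfolding assms
    by (subst circles_chords[where r = "[0, 0, 2, 2, 2, 2]"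
        and w = "(!) [[], [True], [], [True], [True, False], [False]]"])
      (auto simp: less_6_iff card_insert_if)
  show a2b1: "circles a2 b1 = 2"
    unfolding assms
    by (subst circles_chords[where r = "[0, 1, 1, 0, 0, 0]"
        and w = "(!) [[], [], [True], [False], [True, False], [True]]"])
      (auto simp: less_6_iff card_insert_if)
  show a2b2: "circles a2 b2 = 2"
    unfolding assms
    by (subst circles_chords[where r = "[0, 1, 1, 1, 1, 0]"
        and w = "(!) [[], [], [True], [True, False], [False], [True]]"])
      (auto simp: less_6_iff card_insert_if)
  show a2b3: "circles a2 b3 = 2"
    unfolding assms
    by (subst circles_chords[where r = "[0, 0, 0, 3, 3, 0]"
        and w = "(!) [[], [False], [True, False], [], [True], [True]]"])
      (auto simp: less_6_iff card_insert_if)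
  show "circles a2 a1 = 1" using a1a2 by (simp add: Un_commute)
  show "circles b1 a1 = 2" using a1b1 by (simp add: Un_commute)
  show "circles b2 a1 = 2" using a1b2 by (simp add: Un_commute)
  show "circles b3 a1 = 2" using a1b3 by (simp add: Un_commute)
  show "circles b1 a2 = 2" using a2b1 by (simp add: Un_commute)
  show "circles b2 a2 = 2" using a2b2 by (simp add: Un_commute)
  show "circles b3 a2 = 2" using a2b3 by (simp add: Un_commute)
qed

lemma half_turn_chords:
  assumes "length l = 6" "length l' = 6" "\<And>i. i < 6 \<Longrightarrow> l ! i < 6"
    and turn: "\<And>i. i < 6 \<Longrightarrow> l' ! i = (l ! ((i + 3) mod 6) + 3) mod 6"
  shows "half_turn (chords l) = chords l'"
proof -
  have shift: "(j + 3) mod 6 = m \<longleftrightarrow> j = (m + 3) mod 6" if "j < 6" "m < 6" for j m :: nat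
    using that unfolding less_6_iff by (elim disjE) simp_all
  have "(i, j) \<in> half_turn (chords l) \<longleftrightarrow> (i, j) \<in> chords l'" for i j
  proof (cases "i < 6 \<and> j < 6")
    case True
    have "(j + 3) mod 6 = (i + 3) mod 6 \<longleftrightarrow> j = i"
      using True unfolding less_6_iff by (elim conjE disjE) simp_all
    moreover have "(j + 3) mod 6 = l ! ((i + 3) mod 6) \<longleftrightarrow> j = l' ! i"
      using True shift[of j "l ! ((i + 3) mod 6)"] turn[of i] assms(3)[of "(i + 3) mod 6"] by simp
    ultimately show ?thesis using True by (simp add: half_turn_def chords_def assms)
  next
    case False
    then show ?thesis using turn[of i] by (auto simp: half_turn_def chords_def assms)
  qed
  then show ?thesis by auto
qed

text \<open>In the first identity only pairs from a1 and a2 survive: equal matchings form 3 circles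
  and different ones form 1, so the exponents are 2 and 0, and the half turn exchanges them. A
  product of signs on the right is what makes the sum over pairs of states split.\<close>

lemma rotation_formula:
  assumes "E \<in> chords ` noncrossing_matchings" "E' \<in> chords ` noncrossing_matchings"
  shows "loop_value ^ (circles (half_turn E) E' - 1) - loop_value ^ (circles E E' - 1) =
      - (loop_value\<^sup>2 - 1) * (rotation_sign E * rotation_sign E')"
    and "loop_value ^ (circles E (chords [1, 0, 3, 2, 5, 4]) - 1) - loop_value ^ (circles E (chords [5, 2, 1, 4, 3, 0]) - 1) =
      (loop_value\<^sup>2 - 1) * rotation_sign E"
proof -
  let ?a1 = "[1, 0, 3, 2, 5, 4] :: nat list" and ?a2 = "[5, 2, 1, 4, 3, 0] :: nat list"
  let ?b1 = "[3, 2, 1, 0, 5, 4] :: nat list" and ?b2 = "[5, 4, 3, 2, 1, 0] :: nat list"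
  let ?b3 = "[1, 0, 5, 4, 3, 2] :: nat list"
  have turn: "half_turn (chords ?a1) = chords ?a2" "half_turn (chords ?a2) = chords ?a1"
    "half_turn (chords ?b1) = chords ?b1" "half_turn (chords ?b2) = chords ?b2" "half_turn (chords ?b3) = chords ?b3"
    by (rule half_turn_chords; auto simp: less_6_iff)+
  have sign: "rotation_sign (chords ?a1) = 1" "rotation_sign (chords ?a2) = - 1"
    "rotation_sign (chords ?b1) = 0" "rotation_sign (chords ?b2) = 0" "rotation_sign (chords ?b3) = 0"
    by (simp_all add: rotation_sign_def chords_def)
  have E: "E = chords ?a1 \<or> E = chords ?a2 \<or> E = chords ?b1 \<or> E = chords ?b2 \<or> E = chords ?b3"
    and E': "E' = chords ?a1 \<or> E' = chords ?a2 \<or> E' = chords ?b1 \<or> E' = chords ?b2 \<or> E' = chords ?b3"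
    using assms unfolding noncrossing_matchings_def by blast+
  show "loop_value ^ (circles E (chords ?a1) - 1) - loop_value ^ (circles E (chords ?a2) - 1) =
      (loop_value\<^sup>2 - 1) * rotation_sign E"
    using E by (elim disjE; simp only: circles_table sign) (simp_all add: power2_eq_square)
  show "loop_value ^ (circles (half_turn E) E' - 1) - loop_value ^ (circles E E' - 1) =
      - (loop_value\<^sup>2 - 1) * (rotation_sign E * rotation_sign E')"
    using E
  proof (elim disjE)
    assume "E = chords ?a1"
    then show ?thesis
      using E' by (elim disjE; simp only: circles_table sign turn) (simp_all add: power2_eq_square)
  next
    assume "E = chords ?a2"
    then show ?thesis
      using E' by (elim disjE; simp only: circles_table sign turn) (simp_all add: power2_eq_square)
  qed (simp_all only: sign turn, simp_all)
qed

section \<open>Closures and rotation\<close>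

lemma arcs_simps [simp]:
  "edges (arcs m T) = m" "joints (arcs m T) = {}" "crossings (arcs m T) = {}"
  "endpoints (arcs m T) = [1..<Suc (length (endpoints T))]" "darts (arcs m T) = \<Union>m"
  by (simp_all add: arcs_def darts_def)

lemma tangle_diagram_arcs:
  assumes "length (endpoints T) = 2 * n" "pairing m" "\<Union>m = {1..2 * n}"
  shows "tangle_diagram n (arcs m T)"
  using assms by (auto simp: tangle_diagram_def pairing_def disjoint_family_on_def)

lemma loops_arcs:
  assumes "\<Union>m \<subseteq> {1..length (endpoints T)}"
  shows "loops (arcs m T) = 0"
proof -
  have "c \<inter> set (endpoints (arcs m T)) \<noteq> {}"
    if c: "c \<in> classes (darts (arcs m T)) (strand_rel (arcs m T))" for c
  proof -
    obtain x where x: "x \<in> \<Union>m" "c = {y \<in> \<Union>m. (x, y) \<in> gen (strand_rel (arcs m T))}"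
      using c unfolding mem_classes_iff arcs_simps(5) by (elim bexE)
    then have "x \<in> c" by simp
    moreover have "x \<in> set (endpoints (arcs m T))" using x(1) assms by auto
    ultimately show ?thesis by blast
  qed
  then have "{c \<in> classes (darts (arcs m T)) (strand_rel (arcs m T)). c \<inter> set (endpoints (arcs m T)) = {}} = {}"
    by blast
  then show ?thesis unfolding loops_def by (simp only: card.empty)
qed

text \<open>The labelling \<open>f\<close> is constant on each arc and separates different arcs; it
  certifies that nothing else is connected.\<close>

lemma ends_arcs:
  assumes T: "length (endpoints T) = 6" and l: "length l = 6"
    and m: "m = (\<lambda>i. {Suc i, Suc (l ! i)}) ` {..<6}"
    and f: "\<And>i j. i < 6 \<Longrightarrow> j < 6 \<Longrightarrow> f (Suc i) = f (Suc j) \<longleftrightarrow> j = i \<or> j = l ! i"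
    and l6: "\<And>i. i < 6 \<Longrightarrow> l ! i < 6"
  shows "ends (arcs m T) = chords l"
proof -
  let ?R = "strand_rel (arcs m T)"
  have R: "(x, y) \<in> ?R \<longleftrightarrow> {x, y} \<in> m" for x y
    by (simp add: edge_rel_def joint_rel_def)
  have nth: "endpoints (arcs m T) ! i = Suc i" if "i < 6" for i
    using that T by (simp add: nth_upt del: upt_Suc)
  have "(i, j) \<in> ends (arcs m T) \<longleftrightarrow> (i, j) \<in> chords l" for i j
  proof (cases "i < 6 \<and> j < 6")
    case True
    then have "(i, j) \<in> ends (arcs m T) \<longleftrightarrow> (Suc i, Suc j) \<in> gen ?R"
      using nth T unfolding ends_def by (simp del: arcs_simps(4) add: arcs_def)
    also have "\<dots> \<longleftrightarrow> j = i \<or> j = l ! i"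
    proof
      assume "(Suc i, Suc j) \<in> gen ?R"
      then have "f (Suc i) = f (Suc j)"
      proof (rule gen_invariant)
        fix a b assume "(a, b) \<in> ?R"
        then have "{a, b} \<in> m" by (simp only: R)
        then obtain k where k: "k < 6" "{a, b} = {Suc k, Suc (l ! k)}"
          unfolding m by (elim imageE) simp
        then have "f (Suc k) = f (Suc (l ! k))" using f[of k "l ! k"] l6 by simp
        then show "f a = f b" using k(2) by (auto simp: doubleton_eq_iff)
      qed
      then show "j = i \<or> j = l ! i" using f True by simp
    next
      assume "j = i \<or> j = l ! i"
      then show "(Suc i, Suc j) \<in> gen ?R"
      proof
        assume "j = l ! i"
        then have "{Suc i, Suc j} \<in> m" using True unfolding m by blast
        then show ?thesis by (intro gen_base R[THEN iffD2])
      qed simp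
    qed
    finally show ?thesis using True by (simp add: chords_def l)
  next
    case False
    then show ?thesis using l6[of i] T l by (auto simp: ends_def chords_def)
  qed
  then show ?thesis by auto
qed

lemma matching_arcs:
  fixes T :: "'d tangle"
  assumes T: "length (endpoints T) = 6"
  shows "tangle_diagram 3 (arcs m_a1 T)" "tangle_diagram 3 (arcs m_a2 T)"
    "loops (arcs m_a1 T) = 0" "loops (arcs m_a2 T) = 0"
    "ends (arcs m_a1 T) = chords [1, 0, 3, 2, 5, 4]"
    "ends (arcs m_a2 T) = chords [5, 2, 1, 4, 3, 0]"
proof -
  have Un: "\<Union>m_a1 = {1..6}" "\<Union>m_a2 = {1..6}"
    by (auto simp: m_a1_def m_a2_def)
  have "pairing m_a1" "pairing m_a2"
    by (auto simp: pairing_def m_a1_def m_a2_def disjoint_def)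
  then show "tangle_diagram 3 (arcs m_a1 T)" "tangle_diagram 3 (arcs m_a2 T)"
    using Un T by (auto intro!: tangle_diagram_arcs)
  show "loops (arcs m_a1 T) = 0" "loops (arcs m_a2 T) = 0"
    using Un T by (auto intro!: loops_arcs)
  have six: "{..<6} = {0, 1, 2, 3, 4, 5 :: nat}" by auto
  show "ends (arcs m_a1 T) = chords [1, 0, 3, 2, 5, 4]"
  proof (rule ends_arcs[OF T])
    show "m_a1 = (\<lambda>i. {Suc i, Suc ([1, 0, 3, 2, 5, 4] ! i)}) ` {..<6}"
      unfolding six m_a1_def by (simp, intro equalityI) (simp_all add: doubleton_eq_iff)
    \<comment> \<open>Half the endpoint number, rounded up: 1, 2 get label 1, then 3, 4 get 2, and
      5, 6 get 3.\<close>
    show "(Suc i + 1) div 2 = (Suc j + 1) div 2 \<longleftrightarrow> j = i \<or> j = [1, 0, 3, 2, 5, 4] ! i"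
      if "i < 6" "j < 6" for i j
      using that unfolding less_6_iff by (elim disjE) simp_all
  qed (auto simp: less_6_iff)
  show "ends (arcs m_a2 T) = chords [5, 2, 1, 4, 3, 0]"
  proof (rule ends_arcs[OF T])
    show "m_a2 = (\<lambda>i. {Suc i, Suc ([5, 2, 1, 4, 3, 0] ! i)}) ` {..<6}"
      unfolding six m_a2_def by (simp, intro equalityI) (simp_all add: doubleton_eq_iff)
    \<comment> \<open>Halving groups 2, 3 and 4, 5; reduction modulo 3 identifies the label 3 of
      endpoint 6 with the label 0 of endpoint 1.\<close>
    show "(Suc i div 2) mod 3 = (Suc j div 2) mod 3 \<longleftrightarrow> j = i \<or> j = [5, 2, 1, 4, 3, 0] ! i"
      if "i < 6" "j < 6" for i j
      using that unfolding less_6_iff by (elim disjE) simp_all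
  qed (auto simp: less_6_iff)
qed

lemma bracket_closure_difference:
  assumes T: "classical_tangle 3 T"
  shows "bracket (tangle_closure T m_a1) - bracket (tangle_closure T m_a2) =
    (loop_value\<^sup>2 - 1) * (\<Sum>S\<in>Pow (crossings T). state_weight T S * rotation_sign (ends (smoothing S T)))"
proof -
  have diag: "tangle_diagram 3 T" using T by (simp add: classical_tangle_def)
  then have len: "length (endpoints T) = 6" by (simp add: tangle_diagram_def)
  note arcs = matching_arcs[OF len]
  \<comment> \<open>The arcs have only the empty state and no closed strands, so the inner sum over
    their states collapses.\<close>
  have weight: "state_weight (arcs m T) {} = 1" if "loops (arcs m T) = 0" for m
    using that by (simp add: state_weight_def smoothing_crossingless A_pow_0)
  have closure: "bracket (tangle_closure T m) = (\<Sum>S\<in>Pow (crossings T).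
      state_weight T S * loop_value ^ (circles (ends (smoothing S T)) (ends (arcs m T)) - 1))"
    if "tangle_diagram 3 (arcs m T)" "loops (arcs m T) = 0" for m
    using bracket_glue[OF diag that(1)] weight[OF that(2)]
    by (simp add: tangle_closure_def smoothing_crossingless)
  show ?thesis
    unfolding closure[OF arcs(1,3)] closure[OF arcs(2,4)] sum_subtractf[symmetric] sum_distrib_left arcs(5,6)
  proof (rule sum.cong[OF refl])
    fix S
    let ?E = "ends (smoothing S T)"
    have "loop_value ^ (circles ?E (chords [1, 0, 3, 2, 5, 4]) - 1) - loop_value ^ (circles ?E (chords [5, 2, 1, 4, 3, 0]) - 1) =
        (loop_value\<^sup>2 - 1) * rotation_sign ?E"
      using ends_state_classical[OF T] by (intro rotation_formula)
    then show "state_weight T S * loop_value ^ (circles ?E (chords [1, 0, 3, 2, 5, 4]) - 1) -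
        state_weight T S * loop_value ^ (circles ?E (chords [5, 2, 1, 4, 3, 0]) - 1) =
        (loop_value\<^sup>2 - 1) * (state_weight T S * rotation_sign ?E)"
      by (simp only: right_diff_distrib[symmetric]) (simp add: mult_ac)
  qed
qed

section \<open>Effect of the half turn on states and writhe\<close>

lemma rho_3_simps:
  assumes "tangle_diagram 3 T"
  shows "edges (rho 3 T) = edges T" "joints (rho 3 T) = joints T" "crossings (rho 3 T) = crossings T"
    "tails (rho 3 T) = darts T - tails T" "endpoints (rho 3 T) = rotate 3 (endpoints T)"
proof -
  have "length (endpoints T) = 6" using assms by (simp add: tangle_diagram_def)
  \<comment> \<open>\<open>rot\<close> shifts the list to the right and \<open>rotate\<close> to the
    left; for a shift by 3 in a list of 6 they agree, which is evident once the entries are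
    named.\<close>
  then obtain a b c d e f where "endpoints T = [a, b, c, d, e, f]"
    by (auto simp: length_Suc_conv numeral_eq_Suc)
  then show "edges (rho 3 T) = edges T" "joints (rho 3 T) = joints T" "crossings (rho 3 T) = crossings T"
    "tails (rho 3 T) = darts T - tails T" "endpoints (rho 3 T) = rotate 3 (endpoints T)"
    by (simp_all add: rho_def rot_def reverse_orientation_def numeral_3_eq_3 darts_def)
qed

lemma tangle_diagram_rho_3:
  assumes "tangle_diagram 3 T"
  shows "tangle_diagram 3 (rho 3 T)"
proof -
  have "darts (rho 3 T) = darts T" by (simp add: darts_def rho_3_simps[OF assms])
  then show ?thesis
    using assms unfolding tangle_diagram_def rho_3_simps[OF assms] by auto
qed

text \<open>Rotation changes only the list of endpoints and reversal only \<open>tails\<close>,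
  which strands and weights do not consult. So the states are the same, read at shifted
  positions.\<close>

lemma state_rho_3:
  assumes T: "tangle_diagram 3 T"
  shows "state_weight (rho 3 T) S = state_weight T S"
    and "ends (smoothing S (rho 3 T)) = half_turn (ends (smoothing S T))"
proof -
  note rho = rho_3_simps[OF T]
  have len: "length (endpoints T) = 6" using T by (simp add: tangle_diagram_def)
  have joints: "joints (smoothing S (rho 3 T)) = joints (smoothing S T)"
    by (simp add: smoothing_def rho)
  have darts: "darts (rho 3 T) = darts T" by (simp add: darts_def rho)
  have rel: "strand_rel (smoothing S (rho 3 T)) = strand_rel (smoothing S T)"
    by (simp add: edge_rel_def joint_rel_def joints rho)
  show "state_weight (rho 3 T) S = state_weight T S"
    unfolding state_weight_def loops_def rel by (simp add: rho darts)
  have nth: "rotate 3 (endpoints T) ! i = endpoints T ! ((i + 3) mod 6)" if "i < 6" for i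
    using that len by (simp add: nth_rotate add.commute)
  show "ends (smoothing S (rho 3 T)) = half_turn (ends (smoothing S T))"
    unfolding ends_def rel half_turn_def by (auto simp: rho len nth)
qed

text \<open>The product of signs in \<open>rotation_formula\<close> has one factor per tangle, so
  the double sum becomes a product of two single sums. The first is the one found in the closures of
  \<open>T\<close>.\<close>

lemma bracket_rotation_difference:
  assumes T: "classical_tangle 3 T" and T': "classical_complementary_tangle 3 T'"
  shows "bracket (glue (rho 3 T) T') - bracket (glue T T') =
    - (loop_value\<^sup>2 - 1) * (\<Sum>S\<in>Pow (crossings T). state_weight T S * rotation_sign (ends (smoothing S T))) *
      (\<Sum>S'\<in>Pow (crossings T'). state_weight T' S' * rotation_sign (ends (smoothing S' T')))"
proof -
  have diag: "tangle_diagram 3 T" "tangle_diagram 3 T'"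
    using T T' by (simp_all add: classical_tangle_def classical_complementary_tangle_def)
  let ?E = "\<lambda>S. ends (smoothing S T)" and ?E' = "\<lambda>S'. ends (smoothing S' T')"
  have "bracket (glue (rho 3 T) T') = (\<Sum>S\<in>Pow (crossings T). \<Sum>S'\<in>Pow (crossings T').
      state_weight T S * state_weight T' S' * loop_value ^ (circles (half_turn (?E S)) (?E' S') - 1))"
    using bracket_glue[OF tangle_diagram_rho_3[OF diag(1)] diag(2)]
    by (simp add: rho_3_simps[OF diag(1)] state_rho_3[OF diag(1)])
  moreover have "bracket (glue T T') = (\<Sum>S\<in>Pow (crossings T). \<Sum>S'\<in>Pow (crossings T').
      state_weight T S * state_weight T' S' * loop_value ^ (circles (?E S) (?E' S') - 1))"
    using bracket_glue[OF diag] by simp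
  ultimately have "bracket (glue (rho 3 T) T') - bracket (glue T T') =
      (\<Sum>S\<in>Pow (crossings T). \<Sum>S'\<in>Pow (crossings T'). state_weight T S * state_weight T' S' *
        (loop_value ^ (circles (half_turn (?E S)) (?E' S') - 1) - loop_value ^ (circles (?E S) (?E' S') - 1)))"
    by (simp only: right_diff_distrib sum_subtractf)
  also have "\<dots> = (\<Sum>S\<in>Pow (crossings T). \<Sum>S'\<in>Pow (crossings T'). - (loop_value\<^sup>2 - 1) *
      ((state_weight T S * rotation_sign (?E S)) * (state_weight T' S' * rotation_sign (?E' S'))))"
    by (intro sum.cong refl)
      (simp only: rotation_formula(1)[OF ends_state_classical[OF T] ends_state_complementary[OF T']] mult_ac)
  also have "\<dots> = - (loop_value\<^sup>2 - 1) * ((\<Sum>S\<in>Pow (crossings T). state_weight T S * rotation_sign (?E S)) *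
      (\<Sum>S'\<in>Pow (crossings T'). state_weight T' S' * rotation_sign (?E' S')))"
    by (subst sum_product) (simp only: sum_distrib_left)
  finally show ?thesis by (simp only: mult.assoc)
qed

text \<open>Reversal flips membership in \<open>tails\<close> at both \<open>a\<close> and
  \<open>b\<close>, which preserves their agreement. The corners must be known to be darts, since
  tails are complemented within \<open>darts T\<close>.\<close>

lemma writhe_rho_3:
  assumes "tangle_diagram 3 T"
  shows "writhe (rho 3 T) = writhe T"
proof -
  have "crossing_sign (rho 3 T) x = crossing_sign T x" if "x \<in> crossings T" for x
  proof -
    have "corners x \<subseteq> darts T" using assms that by (auto simp: tangle_diagram_def)
    then show ?thesis
      by (cases x) (auto simp: crossing_sign_def corners_def rho_3_simps[OF assms])
  qed
  then show ?thesis by (simp add: writhe_def rho_3_simps[OF assms])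
qed

text \<open>Writing the integers as differences of naturals replaces the case distinctions on the
  signs of \<open>j\<close>, \<open>k\<close> and \<open>j + k\<close> by one computation.\<close>

lemma minus_A3_pow_add: "minus_A3_pow (j + k) = minus_A3_pow j * minus_A3_pow k"
proof -
  have inv: "(- A_pow 3) ^ n * (- A_pow (- 3)) ^ n = 1" for n
    by (simp flip: power_mult_distrib A_pow_add add: A_pow_0)
  have aux: "minus_A3_pow (int m - int n) = (- A_pow 3) ^ m * (- A_pow (- 3)) ^ n" for m n
  proof (cases "m \<ge> n")
    case True
    then have "(- A_pow 3) ^ m = (- A_pow 3) ^ (m - n) * (- A_pow 3) ^ n"
      by (simp flip: power_add)
    then show ?thesis
      using True by (simp add: minus_A3_pow_def mult.assoc inv nat_diff_distrib)
  next
    case False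
    then have "(- A_pow (- 3)) ^ n = (- A_pow (- 3)) ^ m * (- A_pow (- 3)) ^ (n - m)"
      by (simp flip: power_add)
    then show ?thesis
      using False inv[of m] by (simp add: minus_A3_pow_def nat_diff_distrib flip: mult.assoc)
  qed
  obtain m n m' n' where "j = int m - int n" "k = int m' - int n'"
    using int_diff_cases by metis
  moreover from this have "j + k = int (m + m') - int (n + n')" by simp
  ultimately show ?thesis
    by (simp only: aux power_add mult_ac)
qed

theorem theorem3p8:
  fixes T :: "'a tangle" and T' :: "'b tangle"
  assumes "classical_tangle 3 T"
    and "standard_orientation T"
    and "classical_complementary_tangle 3 T'"
    and "compatible_orientation T T'"
  shows "(aux_poly (tangle_closure T m_a1) - aux_poly (tangle_closure T m_a2)) dvd
         (aux_poly (glue (rho 3 T) T') - aux_poly (glue T T'))"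
proof -
  have diag: "tangle_diagram 3 T" "tangle_diagram 3 T'"
    using assms(1,3) by (simp_all add: classical_tangle_def classical_complementary_tangle_def)
  note fin = diag[THEN finite_crossings]
  define X where "X = (\<Sum>S\<in>Pow (crossings T). state_weight T S * rotation_sign (ends (smoothing S T)))"
  define Y where "Y = (\<Sum>S\<in>Pow (crossings T'). state_weight T' S * rotation_sign (ends (smoothing S T')))"
  define u where "u = minus_A3_pow (- writhe T)"
  define u' where "u' = minus_A3_pow (- writhe T')"
  \<comment> \<open>Arcs bring no crossings, so both closures share the unit
    \<open>u\<close>.\<close>
  have "writhe (tangle_closure T m) = writhe T" for m
    using writhe_glue[of T "arcs m T"] fin by (simp add: tangle_closure_def) (simp add: writhe_def)
  then have "aux_poly (tangle_closure T m_a1) - aux_poly (tangle_closure T m_a2) =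
      u * (bracket (tangle_closure T m_a1) - bracket (tangle_closure T m_a2))"
    by (simp only: aux_poly_def u_def right_diff_distrib)
  also have "\<dots> = u * ((loop_value\<^sup>2 - 1) * X)"
    by (simp only: bracket_closure_difference[OF assms(1)] X_def)
  finally have closures: "aux_poly (tangle_closure T m_a1) - aux_poly (tangle_closure T m_a2) = \<dots>" .
  have "minus_A3_pow (- (writhe T + writhe T')) = u * u'"
    by (simp only: u_def u'_def minus_add_distrib minus_A3_pow_add)
  moreover have "writhe (glue (rho 3 T) T') = writhe T + writhe T'" "writhe (glue T T') = writhe T + writhe T'"
    using fin by (simp_all add: writhe_glue rho_3_simps[OF diag(1)] writhe_rho_3[OF diag(1)])
  ultimately have "aux_poly (glue (rho 3 T) T') - aux_poly (glue T T') =
      u * u' * (bracket (glue (rho 3 T) T') - bracket (glue T T'))"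
    by (simp only: aux_poly_def right_diff_distrib)
  also have "\<dots> = u * u' * (- (loop_value\<^sup>2 - 1) * X * Y)"
    by (simp only: bracket_rotation_difference[OF assms(1,3)] X_def Y_def)
  \<comment> \<open>The unit \<open>u\<close> is kept as part of the divisor and need not be
    inverted; \<open>- u' * Y\<close> is the quotient.\<close>
  also have "\<dots> = u * ((loop_value\<^sup>2 - 1) * X) * (- u' * Y)"
    by (simp add: algebra_simps)
  finally show ?thesis
    unfolding closures by (rule dvdI)
qed

end
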